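(* Let $X$ be a weakly special cube complex and $G=\pi_1(X)$. Let $\widetilde{X}\to X$ be the universal cover, $\widetilde{A}\subset\widetilde{X}$ a convex subcomplex and $\tilde{x}\in\widetilde{A}$ a vertex. Let $\widetilde{B}$ be the orthogonal complement of $\widetilde{A}$ at $\tilde{x}$. Then: (1) $\widetilde{B}/G_{\widetilde{B}}$ embeds in $X$. (2) $G_{\widetilde{A}}$ and $G_{\widetilde{B}}$ commute (that is, every element of $G_{\widetilde{A}}$ commutes with every element of $G_{\widetilde{B}}$). (3) $G_{\widetilde{A}}$ and $G_{\widetilde{B}}$ preserve $\widetilde{P}_{\widetilde{A}}=\phi(\widetilde{A}\times\widetilde{B})$; moreover $G_{\widetilde{A}}$ (resp. $G_{\widetilde{B}}$) acts on the $\widetilde{A}$ factor (resp. $\widetilde{B}$ factor) in the natural way and it acts trivially on the other factor.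
   Context: All cube complexes are connected. $G=\pi_1(X)$ acts on $\widetilde{X}$ by deck transformations, and for a convex subcomplex $\widetilde{D}\subset\widetilde{X}$, $G_{\widetilde{D}}$ denotes its (setwise) stabilizer. "$\widetilde{B}/G_{\widetilde{B}}$ embeds in $X$" means the natural map $\widetilde{B}/G_{\widetilde{B}}\to\widetilde{X}/G=X$ is injective. Two edges of a cube complex are elementary parallel if they are opposite edges of a square; parallelism is the equivalence relation generated, and hyperplanes correspond to parallelism classes. A hyperplane $H$ self-intersects if there are distinct edges $e_1,e_2$ dual to $H$, incident at a vertex $x$, that form the corner of a square at $x$; it self-osculates if there are distinct edges $e_1,e_2$ dual to $H$ incident at a vertex $x$ that do not form the corner of a square at $x$, or an edge dual to $H$ with both ends at the same vertex. A non-positively curved cube complex is weakly special if no hyperplane self-intersects or self-osculates. In a CAT(0) cube complex $\widetilde{X}$: for a convex subcomplex $\widetilde{A}$, $\hat{\mathcal{H}}(\widetilde{A})$ is the set of hyperplanes of $\widetilde{X}$ intersecting $\widetilde{A}$. Two hyperplanes are transverse if they are distinct and intersect. $\mathrm{Hull}(S)$ is the smallest convex subcomplex containing $S$. Convex subcomplexes $\widetilde{A},\widetilde{B}$ are orthogonal if their intersection is a single vertex $\tilde{x}$ and every hyperplane in $\hat{\mathcal{H}}(\widetilde{A})$ is transverse to every hyperplane in $\hat{\mathcal{H}}(\widetilde{B})$; in this case there is an isomorphism of CAT(0) cube complexes $\phi:\widetilde{A}\times\widetilde{B}\to\mathrm{Hull}(\widetilde{A}\cup\widetilde{B})$ with $\phi(\tilde{x},\tilde{x})=\tilde{x}$,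 restricting to the identity maps $\widetilde{A}\times\{\tilde{x}\}\to\widetilde{A}$ and $\{\tilde{x}\}\times\widetilde{B}\to\widetilde{B}$. A convex subcomplex $\widetilde{A}'$ is parallel to $\widetilde{A}$ if $\hat{\mathcal{H}}(\widetilde{A}')=\hat{\mathcal{H}}(\widetilde{A})$. The orthogonal complement of $\widetilde{A}$ at a vertex $\tilde{x}\in\widetilde{A}$ is the convex subcomplex $\widetilde{B}$ such that $\tilde{x}\in\widetilde{B}$, $\widetilde{B}$ is orthogonal to $\widetilde{A}$, and the set of convex subcomplexes parallel to $\widetilde{A}$ is precisely the collection of slices $\phi(\widetilde{A}\times\{\tilde{b}\})$ with $\tilde{b}\in\widetilde{B}$ a vertex. Equivalently, $\widetilde{B}$ is the union of all convex subcomplexes containing $\tilde{x}$ that are orthogonal to $\widetilde{A}$. Write $\widetilde{P}_{\widetilde{A}}=\phi(\widetilde{A}\times\widetilde{B})=\mathrm{Hull}(\widetilde{A}\cup\widetilde{B})$. *)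

theory Defs
  imports "HOL-Algebra.Bij"
begin

section \<open>Cube complexes\<close>

text \<open>
  A vertex of the standard cube \<open>[0,1]^n\<close> is encoded as the set \<open>u \<subseteq> {..<n}\<close> of the coordinates
  equal to 1. An isometric embedding (for the Hamming distance) of vertex sets
  \<open>{0,1}^m \<rightarrow> {0,1}^n\<close> is the same thing as an isometry of \<open>[0,1]^m\<close> onto an \<open>m\<close>-dimensional face of
  \<open>[0,1]^n\<close>; for \<open>m = n\<close> these are the symmetries of the cube.
\<close>

definition cube_emb :: "nat \<Rightarrow> nat \<Rightarrow> (nat set \<Rightarrow> nat set) \<Rightarrow> bool" where
  "cube_emb m n f \<longleftrightarrow>
     f \<in> Pow {..<m} \<rightarrow>\<^sub>E Pow {..<n} \<and>
     (\<forall>u\<in>Pow {..<m}. \<forall>v\<in>Pow {..<m}. card (sym_diff (f u) (f v)) = card (sym_diff u v))"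

text \<open>
  A cube complex is given by its parametrised cubes, that is, the maps \<open>[0,1]^n \<rightarrow> X\<close> obtained from
  the characteristic maps of the \<open>n\<close>-cells by precomposing with the symmetries of \<open>[0,1]^n\<close>.
  The function \<open>pull X m f\<close> is precomposition with an embedding \<open>f\<close> of the \<open>m\<close>-cube: it restricts a
  parametrised cube to one of its faces, or reparametrises it. The last axiom below says that
  distinct points of the interior of a cube are never identified. Cubes need not be embedded, and
  neither finite dimension nor local finiteness is required.
\<close>

record 'c cubical =
  cubes :: "'c set"
  cdim :: "'c \<Rightarrow> nat"
  pull :: "nat \<Rightarrow> (nat set \<Rightarrow> nat set) \<Rightarrow> 'c \<Rightarrow> 'c"

locale cube_complex =
  fixes X :: "'c cubical"
  assumes pull_closed:
      "\<lbrakk>c \<in> cubes X; cube_emb m (cdim X c) f\<rbrakk>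
        \<Longrightarrow> pull X m f c \<in> cubes X \<and> cdim X (pull X m f c) = m"
    and pull_id: "c \<in> cubes X \<Longrightarrow> pull X (cdim X c) (\<lambda>u\<in>Pow {..<cdim X c}. u) c = c"
    and pull_comp:
      "\<lbrakk>c \<in> cubes X; cube_emb m (cdim X c) f; cube_emb k m g\<rbrakk>
        \<Longrightarrow> pull X k g (pull X m f c) = pull X k (compose (Pow {..<k}) f g) c"
    and pull_free:
      "\<lbrakk>c \<in> cubes X; cube_emb (cdim X c) (cdim X c) f; pull X (cdim X c) f c = c\<rbrakk>
        \<Longrightarrow> f = (\<lambda>u\<in>Pow {..<cdim X c}. u)"

text \<open>The cell underlying a parametrised cube, represented by the set of its parametrisations.\<close>

definition cell :: "'c cubical \<Rightarrow> 'c \<Rightarrow> 'c set" where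
  "cell X c = {pull X (cdim X c) f c | f. cube_emb (cdim X c) (cdim X c) f}"

definition vertices :: "'c cubical \<Rightarrow> 'c set" where
  "vertices X = {c \<in> cubes X. cdim X c = 0}"

definition corner :: "'c cubical \<Rightarrow> 'c \<Rightarrow> nat set \<Rightarrow> 'c" where
  "corner X c v = pull X 0 (\<lambda>u\<in>Pow {..<0}. v) c"

text \<open>
  \<open>side X c v i\<close> is the edge of \<open>c\<close> in direction \<open>i\<close> at the corner \<open>v\<close>, parametrised so as to start
  at \<open>v\<close>. Parametrised 1-cubes serve as oriented edges; their cells are the edges.
\<close>

definition side :: "'c cubical \<Rightarrow> 'c \<Rightarrow> nat set \<Rightarrow> nat \<Rightarrow> 'c" where
  "side X c v i = pull X 1 (\<lambda>u\<in>Pow {..<1}. if u = {} then v else sym_diff v {i}) c"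

definition arcs :: "'c cubical \<Rightarrow> 'c set" where
  "arcs X = {c \<in> cubes X. cdim X c = 1}"

definition squares :: "'c cubical \<Rightarrow> 'c set" where
  "squares X = {c \<in> cubes X. cdim X c = 2}"

definition edges :: "'c cubical \<Rightarrow> 'c set set" where
  "edges X = cell X ` arcs X"

definition src :: "'c cubical \<Rightarrow> 'c \<Rightarrow> 'c" where
  "src X e = corner X e {}"

definition tgt :: "'c cubical \<Rightarrow> 'c \<Rightarrow> 'c" where
  "tgt X e = corner X e {0}"

definition rev_arc :: "'c cubical \<Rightarrow> 'c \<Rightarrow> 'c" where
  "rev_arc X e = pull X 1 (\<lambda>u\<in>Pow {..<1}. {..<1} - u) e"


section \<open>Edge paths and simple connectedness\<close>

fun edge_path :: "'c cubical \<Rightarrow> 'c \<Rightarrow> 'c list \<Rightarrow> 'c \<Rightarrow> bool" where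
  "edge_path X u [] v \<longleftrightarrow> u \<in> vertices X \<and> u = v"
| "edge_path X u (e # es) v \<longleftrightarrow> e \<in> arcs X \<and> src X e = u \<and> edge_path X (tgt X e) es v"

definition connected_complex :: "'c cubical \<Rightarrow> bool" where
  "connected_complex X \<longleftrightarrow> (\<forall>u\<in>vertices X. \<forall>v\<in>vertices X. \<exists>es. edge_path X u es v)"

inductive elem_homotopic :: "'c cubical \<Rightarrow> 'c list \<Rightarrow> 'c list \<Rightarrow> bool" for X where
  backtrack: "e \<in> arcs X \<Longrightarrow> elem_homotopic X (es @ [e, rev_arc X e] @ fs) (es @ fs)"
| square: "s \<in> squares X \<Longrightarrow>
    elem_homotopic X (es @ [side X s {} 0, side X s {0} 1] @ fs)
                     (es @ [side X s {} 1, side X s {1} 0] @ fs)"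

definition homotopic_paths_in :: "'c cubical \<Rightarrow> 'c \<Rightarrow> 'c \<Rightarrow> 'c list \<Rightarrow> 'c list \<Rightarrow> bool" where
  "homotopic_paths_in X u v =
     equivclp (\<lambda>es fs. edge_path X u es v \<and> edge_path X u fs v \<and> elem_homotopic X es fs)"

definition simply_connected_complex :: "'c cubical \<Rightarrow> bool" where
  "simply_connected_complex X \<longleftrightarrow>
     connected_complex X \<and> (\<forall>u es. edge_path X u es u \<longrightarrow> homotopic_paths_in X u u es [])"


section \<open>Non-positive curvature, hyperplanes, weak specialness\<close>

text \<open>
  Gromov's condition: every vertex link is a flag simplicial complex. The vertices of the link of
  \<open>x\<close> are the oriented edges starting at \<open>x\<close>, and each parametrised \<open>(n+1)\<close>-cube \<open>c\<close> with
  \<open>corner X c {} = x\<close> contributes an \<open>n\<close>-simplex, spanned by \<open>link_simplex X c\<close>; two such cubes give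
  the same simplex iff they differ by a symmetry of the cube fixing the corner \<open>{}\<close>.
\<close>

definition link_simplex :: "'c cubical \<Rightarrow> 'c \<Rightarrow> 'c set" where
  "link_simplex X c = side X c {} ` {..<cdim X c}"

definition simplicial_link :: "'c cubical \<Rightarrow> 'c \<Rightarrow> bool" where
  "simplicial_link X x \<longleftrightarrow>
     (\<forall>c\<in>cubes X. corner X c {} = x \<longrightarrow> inj_on (side X c {}) {..<cdim X c}) \<and>
     (\<forall>c\<in>cubes X. \<forall>d\<in>cubes X.
        corner X c {} = x \<and> corner X d {} = x \<and> link_simplex X c = link_simplex X d \<longrightarrow>
        (\<exists>f. cube_emb (cdim X d) (cdim X c) f \<and> f {} = {} \<and> d = pull X (cdim X d) f c))"

definition flag_link :: "'c cubical \<Rightarrow> 'c \<Rightarrow> bool" where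
  "flag_link X x \<longleftrightarrow>
     (\<forall>E. finite E \<and> E \<subseteq> {e \<in> arcs X. src X e = x} \<and>
        (\<forall>e\<in>E. \<forall>e'\<in>E. e \<noteq> e' \<longrightarrow>
           (\<exists>s\<in>squares X. corner X s {} = x \<and> link_simplex X s = {e, e'})) \<longrightarrow>
        (\<exists>c\<in>cubes X. corner X c {} = x \<and> link_simplex X c = E))"

definition nonpositively_curved :: "'c cubical \<Rightarrow> bool" where
  "nonpositively_curved X \<longleftrightarrow> (\<forall>x\<in>vertices X. simplicial_link X x \<and> flag_link X x)"

definition elem_parallel :: "'c cubical \<Rightarrow> 'c set \<Rightarrow> 'c set \<Rightarrow> bool" where
  "elem_parallel X E F \<longleftrightarrow>
     (\<exists>s\<in>squares X. E = cell X (side X s {} 0) \<and> F = cell X (side X s {1} 0))"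

text \<open>A hyperplane is represented by the set of edges dual to it.\<close>

definition hyperplanes :: "'c cubical \<Rightarrow> 'c set set set" where
  "hyperplanes X = {{F. equivclp (elem_parallel X) E F} | E. E \<in> edges X}"

definition incident :: "'c cubical \<Rightarrow> 'c set \<Rightarrow> 'c \<Rightarrow> bool" where
  "incident X E x \<longleftrightarrow> (\<exists>e\<in>E. src X e = x)"

definition forms_corner :: "'c cubical \<Rightarrow> 'c set \<Rightarrow> 'c set \<Rightarrow> 'c \<Rightarrow> bool" where
  "forms_corner X E F x \<longleftrightarrow>
     (\<exists>s\<in>squares X. corner X s {} = x \<and> E = cell X (side X s {} 0) \<and> F = cell X (side X s {} 1))"

definition self_intersects :: "'c cubical \<Rightarrow> 'c set set \<Rightarrow> bool" where
  "self_intersects X H \<longleftrightarrow>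
     (\<exists>E\<in>H. \<exists>F\<in>H. \<exists>x\<in>vertices X.
        E \<noteq> F \<and> incident X E x \<and> incident X F x \<and> forms_corner X E F x)"

definition self_osculates :: "'c cubical \<Rightarrow> 'c set set \<Rightarrow> bool" where
  "self_osculates X H \<longleftrightarrow>
     (\<exists>E\<in>H. \<exists>F\<in>H. \<exists>x\<in>vertices X.
        E \<noteq> F \<and> incident X E x \<and> incident X F x \<and> \<not> forms_corner X E F x) \<or>
     (\<exists>E\<in>H. \<exists>e\<in>E. src X e = tgt X e)"

definition weakly_special :: "'c cubical \<Rightarrow> bool" where
  "weakly_special X \<longleftrightarrow>
     nonpositively_curved X \<and> (\<forall>H\<in>hyperplanes X. \<not> self_intersects X H \<and> \<not> self_osculates X H)"


section \<open>Universal covers and deck transformations\<close>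

definition cubical_map :: "'a cubical \<Rightarrow> ('a \<Rightarrow> 'b) \<Rightarrow> 'b cubical \<Rightarrow> bool" where
  "cubical_map Y p X \<longleftrightarrow>
     (\<forall>c\<in>cubes Y. p c \<in> cubes X \<and> cdim X (p c) = cdim Y c \<and>
        (\<forall>m f. cube_emb m (cdim Y c) f \<longrightarrow> p (pull Y m f c) = pull X m f (p c)))"

text \<open>A covering map is a surjective map of cube complexes that is bijective on vertex stars.\<close>

definition covering_map_of :: "'a cubical \<Rightarrow> ('a \<Rightarrow> 'b) \<Rightarrow> 'b cubical \<Rightarrow> bool" where
  "covering_map_of Y p X \<longleftrightarrow>
     cubical_map Y p X \<and> p ` vertices Y = vertices X \<and>
     (\<forall>v\<in>vertices Y. \<forall>c\<in>cubes X. corner X c {} = p v \<longrightarrow>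
        (\<exists>!d. d \<in> cubes Y \<and> corner Y d {} = v \<and> p d = c))"

definition universal_cover :: "'a cubical \<Rightarrow> ('a \<Rightarrow> 'b) \<Rightarrow> 'b cubical \<Rightarrow> bool" where
  "universal_cover Y p X \<longleftrightarrow>
     cube_complex Y \<and> simply_connected_complex Y \<and> covering_map_of Y p X"

definition deck_group :: "'a cubical \<Rightarrow> ('a \<Rightarrow> 'b) \<Rightarrow> ('a \<Rightarrow> 'a) monoid" where
  "deck_group Y p =
     (BijGroup (cubes Y))\<lparr>carrier :=
        {g \<in> Bij (cubes Y). cubical_map Y g Y \<and> (\<forall>c\<in>cubes Y. p (g c) = p c)}\<rparr>"

lemma group_deck_group:
  assumes "cube_complex Y"
  shows "group (deck_group Y p)"
proof -
  interpret cube_complex Y by fact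
  let ?S = "cubes Y"
  let ?D = "{g \<in> Bij ?S. cubical_map Y g Y \<and> (\<forall>c\<in>?S. p (g c) = p c)}"
  have "subgroup ?D (BijGroup ?S)"
  proof (rule group.subgroupI[OF group_BijGroup])
    show "?D \<subseteq> carrier (BijGroup ?S)"
      by (auto simp: BijGroup_def)
    have "(\<lambda>c\<in>?S. c) \<in> ?D"
      using pull_closed by (auto simp: id_Bij cubical_map_def)
    then show "?D \<noteq> {}" by blast
  next
    fix g assume g: "g \<in> ?D"
    define h where "h = (\<lambda>c\<in>?S. inv_into ?S g c)"
    have bij: "bij_betw g ?S ?S" using g by (auto simp: Bij_def)
    have h_in: "h c \<in> ?S" and gh: "g (h c) = c" if "c \<in> ?S" for c
      using that bij by (auto simp: h_def bij_betw_def inv_into_into f_inv_into_f)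
    have hg: "h (g c) = c" if "c \<in> ?S" for c
      using that bij by (auto simp: h_def bij_betw_def inv_into_f_f)
    have dim: "cdim Y (h c) = cdim Y c" if "c \<in> ?S" for c
      using g h_in[OF that] gh[OF that] by (auto simp: cubical_map_def)
    have "h (pull Y m f c) = pull Y m f (h c)" if c: "c \<in> ?S" and f: "cube_emb m (cdim Y c) f" for c m f
    proof -
      have "g (pull Y m f (h c)) = pull Y m f c"
        using g h_in[OF c] gh[OF c] dim[OF c] f by (auto simp: cubical_map_def)
      moreover have "pull Y m f (h c) \<in> ?S"
        using pull_closed h_in[OF c] dim[OF c] f by auto
      ultimately show ?thesis using hg by metis
    qed
    moreover have "p (h c) = p c" if "c \<in> ?S" for c
      using g h_in[OF that] gh[OF that] by (metis (mono_tags, lifting) mem_Collect_eq)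
    moreover have "h \<in> Bij ?S"
      using g by (simp add: h_def restrict_inv_into_Bij)
    ultimately have "h \<in> ?D"
      using h_in dim by (auto simp: cubical_map_def)
    moreover have "inv\<^bsub>BijGroup ?S\<^esub> g = h"
      using g by (simp add: h_def inv_BijGroup)
    ultimately show "inv\<^bsub>BijGroup ?S\<^esub> g \<in> ?D" by simp
  next
    fix g h assume "g \<in> ?D" "h \<in> ?D"
    then show "g \<otimes>\<^bsub>BijGroup ?S\<^esub> h \<in> ?D"
      using pull_closed
      by (auto simp: BijGroup_def compose_Bij cubical_map_def compose_eq)
  qed
  then show ?thesis
    unfolding deck_group_def by (rule group.subgroup_imp_group[OF group_BijGroup])
qed

definition set_stabilizer :: "('a \<Rightarrow> 'a) monoid \<Rightarrow> 'a set \<Rightarrow> ('a \<Rightarrow> 'a) set" where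
  "set_stabilizer G S = {g \<in> carrier G. g ` S = S}"

definition orbits_under :: "('a \<Rightarrow> 'a) set \<Rightarrow> 'a set \<Rightarrow> 'a set set" where
  "orbits_under K S = (\<lambda>c. {g c | g. g \<in> K}) ` S"

text \<open>
  For \<open>K\<close> consisting of deck transformations of \<open>p\<close>, this says that the natural map from the
  quotient \<open>S/K\<close> to the base of \<open>p\<close> is injective. As the cubes are parametrised, this is the same as
  injectivity on points.
\<close>

definition quotient_embeds :: "('a \<Rightarrow> 'b) \<Rightarrow> ('a \<Rightarrow> 'a) set \<Rightarrow> 'a set \<Rightarrow> bool" where
  "quotient_embeds p K S \<longleftrightarrow> inj_on (\<lambda>orb. the_elem (p ` orb)) (orbits_under K S)"


section \<open>Convex subcomplexes and orthogonal complements\<close>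

text \<open>The following notions are meant for a CAT(0) cube complex \<open>X\<close>.\<close>

definition subcomplex :: "'c cubical \<Rightarrow> 'c set \<Rightarrow> bool" where
  "subcomplex X S \<longleftrightarrow>
     S \<subseteq> cubes X \<and> (\<forall>c\<in>S. \<forall>m f. cube_emb m (cdim X c) f \<longrightarrow> pull X m f c \<in> S)"

definition geodesic :: "'c cubical \<Rightarrow> 'c \<Rightarrow> 'c list \<Rightarrow> 'c \<Rightarrow> bool" where
  "geodesic X u es v \<longleftrightarrow>
     edge_path X u es v \<and> (\<forall>fs. edge_path X u fs v \<longrightarrow> length es \<le> length fs)"

text \<open>
  Combinatorial convexity: a full subcomplex containing all edge geodesics between its vertices.
  Convex subcomplexes are required to be nonempty; otherwise the empty set would be parallel to every
  single vertex.
\<close>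

definition convex_subcomplex :: "'c cubical \<Rightarrow> 'c set \<Rightarrow> bool" where
  "convex_subcomplex X S \<longleftrightarrow>
     subcomplex X S \<and> S \<noteq> {} \<and>
     (\<forall>u\<in>S. \<forall>v\<in>S. \<forall>es. geodesic X u es v \<longrightarrow> set es \<subseteq> S) \<and>
     (\<forall>c\<in>cubes X. (\<forall>u\<in>Pow {..<cdim X c}. corner X c u \<in> S) \<longrightarrow> c \<in> S)"

definition Hull :: "'c cubical \<Rightarrow> 'c set \<Rightarrow> 'c set" where
  "Hull X S = \<Inter>{C. convex_subcomplex X C \<and> S \<subseteq> C}"

definition hyperplanes_of :: "'c cubical \<Rightarrow> 'c set \<Rightarrow> 'c set set set" where
  "hyperplanes_of X A = {H \<in> hyperplanes X. \<exists>e\<in>A. cdim X e = 1 \<and> cell X e \<in> H}"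

text \<open>Two distinct hyperplanes intersect iff their midcubes cross in some square.\<close>

definition transverse :: "'c cubical \<Rightarrow> 'c set set \<Rightarrow> 'c set set \<Rightarrow> bool" where
  "transverse X H K \<longleftrightarrow>
     H \<noteq> K \<and> (\<exists>s\<in>squares X. cell X (side X s {} 0) \<in> H \<and> cell X (side X s {} 1) \<in> K)"

definition orthogonal_at :: "'c cubical \<Rightarrow> 'c set \<Rightarrow> 'c set \<Rightarrow> 'c \<Rightarrow> bool" where
  "orthogonal_at X A B x \<longleftrightarrow>
     convex_subcomplex X A \<and> convex_subcomplex X B \<and> x \<in> vertices X \<and> A \<inter> B = {x} \<and>
     (\<forall>H\<in>hyperplanes_of X A. \<forall>K\<in>hyperplanes_of X B. transverse X H K)"

definition parallel_subcomplex :: "'c cubical \<Rightarrow> 'c set \<Rightarrow> 'c set \<Rightarrow> bool" where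
  "parallel_subcomplex X A' A \<longleftrightarrow>
     convex_subcomplex X A' \<and> hyperplanes_of X A' = hyperplanes_of X A"

text \<open>
  The product \<open>f \<times> g\<close> of embeddings \<open>f : [0,1]^m \<rightarrow> [0,1]^p\<close> and \<open>g : [0,1]^n \<rightarrow> [0,1]^q\<close>, where the
  coordinates of the second factor are placed after those of the first.
\<close>

definition emb_prod ::
    "nat \<Rightarrow> nat \<Rightarrow> nat \<Rightarrow> (nat set \<Rightarrow> nat set) \<Rightarrow> (nat set \<Rightarrow> nat set) \<Rightarrow> nat set \<Rightarrow> nat set" where
  "emb_prod m n p f g = (\<lambda>u\<in>Pow {..<m + n}. f (u \<inter> {..<m}) \<union> (+) p ` g ((+) m -` u))"

text \<open>
  An isomorphism of cube complexes from \<open>A \<times> B\<close> onto \<open>Hull(A \<union> B)\<close> restricting to the identity on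
  \<open>A \<times> {x}\<close> and \<open>{x} \<times> B\<close>. The cells of \<open>A \<times> B\<close> are the products of a cell of \<open>A\<close> and a cell of
  \<open>B\<close>, and up to a symmetry of the cube every parametrised cube of \<open>A \<times> B\<close> is a product \<open>a \<times> b\<close>. So
  the isomorphism is given by its values \<open>\<phi> a b\<close> on these; it has to be compatible with faces and
  reparametrisations and bijective on cells.
\<close>

definition product_iso :: "'c cubical \<Rightarrow> 'c set \<Rightarrow> 'c set \<Rightarrow> 'c \<Rightarrow> ('c \<Rightarrow> 'c \<Rightarrow> 'c) \<Rightarrow> bool" where
  "product_iso X A B x \<phi> \<longleftrightarrow>
     (\<forall>a\<in>A. \<forall>b\<in>B. \<phi> a b \<in> Hull X (A \<union> B) \<and> cdim X (\<phi> a b) = cdim X a + cdim X b) \<and>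
     (\<forall>a\<in>A. \<forall>b\<in>B. \<forall>m n f g. cube_emb m (cdim X a) f \<and> cube_emb n (cdim X b) g \<longrightarrow>
        pull X (m + n) (emb_prod m n (cdim X a) f g) (\<phi> a b) = \<phi> (pull X m f a) (pull X n g b)) \<and>
     (\<forall>c\<in>Hull X (A \<union> B). \<exists>a\<in>A. \<exists>b\<in>B. cell X c = cell X (\<phi> a b)) \<and>
     (\<forall>a\<in>A. \<forall>b\<in>B. \<forall>a'\<in>A. \<forall>b'\<in>B. cell X (\<phi> a b) = cell X (\<phi> a' b') \<longrightarrow>
        cell X a = cell X a' \<and> cell X b = cell X b') \<and>
     (\<forall>a\<in>A. \<phi> a x = a) \<and> (\<forall>b\<in>B. \<phi> x b = b)"

definition slice :: "('c \<Rightarrow> 'c \<Rightarrow> 'c) \<Rightarrow> 'c set \<Rightarrow> 'c \<Rightarrow> 'c set" where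
  "slice \<phi> A b = (\<lambda>a. \<phi> a b) ` A"

definition orthogonal_complement :: "'c cubical \<Rightarrow> 'c set \<Rightarrow> 'c \<Rightarrow> 'c set \<Rightarrow> bool" where
  "orthogonal_complement X A x B \<longleftrightarrow>
     orthogonal_at X A B x \<and>
     (\<exists>\<phi>. product_iso X A B x \<phi> \<and>
          {A'. parallel_subcomplex X A' A} = {slice \<phi> A b | b. b \<in> B \<inter> vertices X})"

end

theory Submission
  imports Defs
begin

text \<open>
  The proof rests on one rigidity property. In a weakly special complex an oriented edge is
  determined by its starting vertex and the hyperplane dual to it: two edges of one hyperplane at
  the same vertex would make it self-intersect or self-osculate. As links are simplicial, a cube is
  therefore determined by one of its corners and the hyperplanes dual to its sides there
  (\<open>weakly_special_cube_eqI\<close>).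

  The squares of \<open>\<phi>(A \<times> B)\<close> show that the sides of \<open>\<phi> a b\<close> are parallel to those of \<open>a\<close> and of \<open>b\<close>.
  So the image of \<open>\<phi> a b\<close> in the base depends only on the images of \<open>a\<close> and \<open>b\<close> and on the image of
  one corner. Lifting this to the cover gives the central result (\<open>deck_product_equivariant\<close>): if \<open>g\<close>
  is a deck transformation and \<open>\<alpha>\<close>, \<open>\<beta>\<close> are cubical maps into \<open>A\<close> and \<open>B\<close> which do not change the image
  in the base, then \<open>g (\<phi> a b) = \<phi> (\<alpha> a) (\<beta> b)\<close> holds everywhere as soon as it holds at one vertex.

  For \<open>g\<close> in the stabilizer of \<open>A\<close>, take \<open>\<alpha> = g\<close> and \<open>\<beta> = id\<close>; at the vertex \<open>x\<close> the equation
  reads \<open>g x = g x\<close>. This, with the mirror image for \<open>B\<close>, is the description of the two actions on the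
  product. If \<open>g\<close> stabilizes \<open>A\<close> and \<open>h\<close> stabilizes \<open>B\<close>, then \<open>g h\<close> and \<open>h g\<close> both send \<open>x\<close> to
  \<open>\<phi> (g x) (h x)\<close>, and a deck transformation is determined by its value at one vertex.

  For the embedding of the quotient, two cubes of \<open>B\<close> with the same image differ by a deck
  transformation \<open>g\<close>, and one has to show that \<open>g\<close> preserves \<open>B\<close>. Taking \<open>\<alpha> = id\<close> on a single slice,
  \<open>g\<close> maps the slice at \<open>b\<close> to the slice at \<open>g b\<close> whenever \<open>b\<close> and \<open>g b\<close> lie in \<open>B\<close>. Then \<open>g\<close> preserves the
  set of hyperplanes of \<open>A\<close>, hence permutes the parallel copies of \<open>A\<close>, which are the slices. So
  for an edge \<open>f\<close> of \<open>B\<close> at \<open>b\<close> the edge \<open>g f\<close> lies in the product and starts in \<open>B\<close>; it is then an edge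
  of \<open>B\<close> or of the slice at \<open>g b\<close>, and the latter is excluded because \<open>f\<close> is not in the slice at \<open>b\<close>
  (\<open>deck_preserves_B_step\<close>). Moving along edges of \<open>B\<close> gives \<open>g B \<subseteq> B\<close>.
\<close>

section \<open>Faces of parametrised cubes\<close>

abbreviation corner_emb :: "nat set \<Rightarrow> nat set \<Rightarrow> nat set" where
  "corner_emb v \<equiv> (\<lambda>u\<in>Pow {..<0}. v)"

abbreviation side_emb :: "nat set \<Rightarrow> nat \<Rightarrow> nat set \<Rightarrow> nat set" where
  "side_emb v i \<equiv> (\<lambda>u\<in>Pow {..<1}. if u = {} then v else sym_diff v {i})"

abbreviation id_emb :: "nat \<Rightarrow> nat set \<Rightarrow> nat set" where
  "id_emb n \<equiv> (\<lambda>u\<in>Pow {..<n}. u)"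

lemma Pow_lessThan_one: "Pow {..<1::nat} = {{}, {0}}"
  by (auto simp: lessThan_Suc Pow_insert)

lemma restrict_Pow_one_eqI:
  assumes "F {} = G {}" "F {0} = G {0}"
  shows "restrict F (Pow {..<1::nat}) = restrict G (Pow {..<1})"
  unfolding Pow_lessThan_one using assms by (intro restrict_ext) blast

lemma restrict_Pow_zero_eqI: "F {} = G {} \<Longrightarrow> restrict F (Pow {..<0::nat}) = restrict G (Pow {..<0})"
  by (intro restrict_ext) simp

lemma cube_emb_in: "cube_emb m n f \<Longrightarrow> u \<subseteq> {..<m} \<Longrightarrow> f u \<subseteq> {..<n}"
  unfolding cube_emb_def by (meson Pow_iff PiE_mem)

lemma cube_emb_dist:
  "cube_emb m n f \<Longrightarrow> u \<subseteq> {..<m} \<Longrightarrow> v \<subseteq> {..<m} \<Longrightarrow>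
    card (sym_diff (f u) (f v)) = card (sym_diff u v)"
  unfolding cube_emb_def by blast

lemma cube_emb_ext: 
  assumes "cube_emb m n f" "cube_emb m n' g" "\<And>u. u \<subseteq> {..<m} \<Longrightarrow> f u = g u"
  shows "f = g"
  using assms unfolding cube_emb_def
  by (intro extensionalityI[of f "Pow {..<m}" g]) (auto simp: PiE_def)

lemma cube_emb_corner: "v \<subseteq> {..<n} \<Longrightarrow> cube_emb 0 n (corner_emb v)"
  by (auto simp: cube_emb_def)

lemma cube_emb_side:
  assumes "v \<subseteq> {..<n}" "i < n"
  shows "cube_emb 1 n (side_emb v i)"
proof -
  have "sym_diff v (sym_diff v {i}) = {i}" "sym_diff (sym_diff v {i}) v = {i}" by auto
  then show ?thesis
    using assms unfolding cube_emb_def Pow_lessThan_one by auto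
qed

lemma cube_emb_id: "cube_emb n n (id_emb n)"
  by (auto simp: cube_emb_def)

lemma cube_emb_zero:
  assumes "cube_emb m 0 f"
  shows "m = 0 \<and> f = id_emb 0"
proof -
  have "f {} = {}" "f {..<m} = {}"
    using cube_emb_in[OF assms, of "{}"] cube_emb_in[OF assms, of "{..<m}"] by auto
  then have m: "m = 0"
    using cube_emb_dist[OF assms, of "{}" "{..<m}"] by simp
  moreover have "f = id_emb 0"
    using assms m \<open>f {} = {}\<close> by (intro cube_emb_ext[OF _ cube_emb_id]) auto
  ultimately show ?thesis by simp
qed

lemma cube_emb_one_one:
  assumes "cube_emb 1 1 f"
  shows "f = id_emb 1 \<or> f {} = {0} \<and> f {0} = {}"
proof -
  have "f {} \<in> {{}, {0}}" "f {0} \<in> {{}, {0}}"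
    using cube_emb_in[OF assms, of "{}"] cube_emb_in[OF assms, of "{0}"] Pow_lessThan_one by auto
  moreover have "f {} \<noteq> f {0}"
    using cube_emb_dist[OF assms, of "{}" "{0}"] by auto
  moreover have "f = id_emb 1" if "f {} = {}" "f {0} = {0}"
    using that Pow_lessThan_one by (intro cube_emb_ext[OF assms cube_emb_id]) auto
  ultimately show ?thesis by auto
qed

text \<open>
  A subset \<open>u\<close> of the coordinates is recovered from Hamming distances alone: \<open>i \<in> u\<close> exactly
  when \<open>{i}\<close> is less far from \<open>u\<close> than the corner \<open>{}\<close> is.
\<close>

lemma cube_emb_fixing_axes:
  assumes f: "cube_emb n n f" and "f {} = {}" and ax: "\<And>i. i < n \<Longrightarrow> f {i} = {i}"
  shows "f = id_emb n"
proof (rule cube_emb_ext[OF f cube_emb_id])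
  fix u :: "nat set" assume u: "u \<subseteq> {..<n}"
  have fu: "f u \<subseteq> {..<n}" using cube_emb_in[OF f u] .
  have fin: "finite u" "finite (f u)" using u fu finite_subset by blast+
  have cu: "card (f u) = card u" using cube_emb_dist[OF f u, of "{}"] assms(2) by simp
  have aux: "i \<in> w \<longleftrightarrow> card (sym_diff w {i}) < card w" if "finite w" for i and w :: "nat set"
  proof (cases "i \<in> w")
    case True
    then have "sym_diff w {i} = w - {i}" by auto
    then show ?thesis using True that by (simp only: card_Diff1_less)
  next
    case False
    then have "sym_diff w {i} = insert i w" by auto
    then show ?thesis using False that by simp
  qed
  have "i \<in> f u \<longleftrightarrow> i \<in> u" if "i < n" for i
  proof -
    have d: "card (sym_diff (f u) {i}) = card (sym_diff u {i})"
      using cube_emb_dist[OF f u, of "{i}"] ax[OF that] that by simp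
    show ?thesis by (simp only: aux[OF fin(1)] aux[OF fin(2)] d cu)
  qed
  then show "f u = id_emb n u" using u fu by auto
qed

text \<open>
  The symmetry exchanging the two coordinates of a square. Parallelism is defined through the
  sides in direction 0; this symmetry makes it available in direction 1.
\<close>

definition swap_emb :: "nat set \<Rightarrow> nat set" where
  "swap_emb = (\<lambda>u\<in>Pow {..<2}. (\<lambda>i. 1 - i) ` u)"

lemma cube_emb_swap: "cube_emb 2 2 swap_emb"
proof -
  have inj: "inj_on (\<lambda>i. 1 - i) {..<2::nat}" by (auto simp: inj_on_def)
  have "card (sym_diff ((\<lambda>i. 1 - i) ` u) ((\<lambda>i. 1 - i) ` v)) = card (sym_diff u v)"
    if "u \<subseteq> {..<2}" "v \<subseteq> {..<2}" for u v :: "nat set"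
  proof -
    have "(\<lambda>i. 1 - i) ` (u - v) = (\<lambda>i. 1 - i) ` u - (\<lambda>i. 1 - i) ` v"
      by (rule inj_on_image_set_diff[OF inj]) (use that in blast)+
    moreover have "(\<lambda>i. 1 - i) ` (v - u) = (\<lambda>i. 1 - i) ` v - (\<lambda>i. 1 - i) ` u"
      by (rule inj_on_image_set_diff[OF inj]) (use that in blast)+
    ultimately have "sym_diff ((\<lambda>i. 1 - i) ` u) ((\<lambda>i. 1 - i) ` v) = (\<lambda>i. 1 - i) ` sym_diff u v"
      by (simp only: image_Un)
    moreover have "inj_on (\<lambda>i. 1 - i) (sym_diff u v)"
      using that by (intro inj_on_subset[OF inj]) auto
    ultimately show ?thesis by (simp add: card_image)
  qed
  moreover have "(\<lambda>i. 1 - i) ` u \<subseteq> {..<2}" for u :: "nat set" by auto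
  ultimately show ?thesis by (simp add: cube_emb_def swap_emb_def PiE_def Pi_def)
qed

lemma cube_emb_rev: "cube_emb 1 1 (\<lambda>u\<in>Pow {..<1}. {..<1} - u)"
  unfolding cube_emb_def Pow_lessThan_one by (auto simp: lessThan_Suc)

context cube_complex
begin

lemma pull_in: "c \<in> cubes X \<Longrightarrow> cube_emb m (cdim X c) f \<Longrightarrow> pull X m f c \<in> cubes X"
  and cdim_pull: "c \<in> cubes X \<Longrightarrow> cube_emb m (cdim X c) f \<Longrightarrow> cdim X (pull X m f c) = m"
  using pull_closed by auto

lemma corner_pull:
  assumes "c \<in> cubes X" "cube_emb m (cdim X c) f" "v \<subseteq> {..<m}"
  shows "corner X (pull X m f c) v = corner X c (f v)"
proof -
  have "compose (Pow {..<0}) f (corner_emb v) = corner_emb (f v)"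
    by (simp add: compose_def fun_eq_iff restrict_def)
  then show ?thesis
    using pull_comp[OF assms(1,2) cube_emb_corner[OF assms(3)]] by (simp add: corner_def)
qed

lemma side_pull:
  assumes "c \<in> cubes X" "cube_emb m (cdim X c) f" "v \<subseteq> {..<m}" "i < m"
    and "f (sym_diff v {i}) = sym_diff (f v) {j}"
  shows "side X (pull X m f c) v i = side X c (f v) j"
proof -
  have "compose (Pow {..<1}) f (side_emb v i) = side_emb (f v) j"
    using assms(5) by (simp add: compose_def fun_eq_iff restrict_def)
  then show ?thesis
    using pull_comp[OF assms(1,2) cube_emb_side[OF assms(3,4)]] by (simp add: side_def)
qed

lemma corner_vertex:
  assumes "c \<in> cubes X" "v \<subseteq> {..<cdim X c}"
  shows "corner X c v \<in> vertices X"
  unfolding corner_def vertices_def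
  using pull_closed[OF assms(1) cube_emb_corner[OF assms(2)]] by (rule CollectI)

lemma
  assumes "c \<in> cubes X" "v \<subseteq> {..<cdim X c}" "i < cdim X c"
  shows side_arc: "side X c v i \<in> arcs X"
    and src_side: "src X (side X c v i) = corner X c v"
    and tgt_side: "tgt X (side X c v i) = corner X c (sym_diff v {i})"
proof -
  have emb: "cube_emb 1 (cdim X c) (side_emb v i)"
    using cube_emb_side assms by blast
  show "side X c v i \<in> arcs X"
    unfolding side_def arcs_def using pull_closed[OF assms(1) emb] by (rule CollectI)
  show "src X (side X c v i) = corner X c v"
    unfolding side_def src_def by (subst corner_pull[OF assms(1) emb]) auto
  show "tgt X (side X c v i) = corner X c (sym_diff v {i})"
    unfolding side_def tgt_def by (subst corner_pull[OF assms(1) emb]) auto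
qed

lemma corner_of_vertex: "v \<in> vertices X \<Longrightarrow> corner X v {} = v"
proof -
  assume v: "v \<in> vertices X"
  have "corner_emb {} = id_emb 0" by (rule restrict_Pow_zero_eqI) simp
  then show ?thesis using v pull_id[of v] by (auto simp: vertices_def corner_def)
qed

lemma side_of_arc: "e \<in> arcs X \<Longrightarrow> side X e {} 0 = e"
proof -
  assume e: "e \<in> arcs X"
  have "side_emb {} 0 = id_emb 1" by (rule restrict_Pow_one_eqI) auto
  then show ?thesis using e pull_id[of e] by (auto simp: arcs_def side_def)
qed

lemma src_vertex: "e \<in> arcs X \<Longrightarrow> src X e \<in> vertices X"
  and tgt_vertex: "e \<in> arcs X \<Longrightarrow> tgt X e \<in> vertices X"
  unfolding src_def tgt_def arcs_def by (auto intro!: corner_vertex)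

lemma rev_arc_facts:
  assumes "e \<in> arcs X"
  shows "rev_arc X e \<in> arcs X" "src X (rev_arc X e) = tgt X e" "tgt X (rev_arc X e) = src X e"
proof -
  have e: "e \<in> cubes X" "cdim X e = 1" using assms by (auto simp: arcs_def)
  show "rev_arc X e \<in> arcs X"
    using pull_closed[OF e(1)] cube_emb_rev e unfolding arcs_def rev_arc_def by auto
  show "src X (rev_arc X e) = tgt X e" "tgt X (rev_arc X e) = src X e"
    unfolding src_def tgt_def rev_arc_def
    using corner_pull[OF e(1), of 1 _ "{}"] corner_pull[OF e(1), of 1 _ "{0}"] cube_emb_rev e
    by (auto simp: Pow_lessThan_one lessThan_Suc)
qed

lemma self_in_cell: "c \<in> cubes X \<Longrightarrow> c \<in> cell X c"
  unfolding cell_def using pull_id[of c] cube_emb_id by force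

lemma cell_eqD:
  assumes "c \<in> cubes X" "cell X c = cell X d"
  obtains f where "cube_emb (cdim X d) (cdim X d) f" "c = pull X (cdim X d) f d"
  using self_in_cell[OF assms(1)] assms(2) unfolding cell_def by auto

lemma cell_vertex_inj:
  assumes "u \<in> vertices X" "v \<in> cubes X" "cell X v = cell X u"
  shows "v = u"
proof -
  obtain f where "cube_emb (cdim X u) (cdim X u) f" "v = pull X (cdim X u) f u"
    using cell_eqD[OF assms(2,3)] by blast
  then show ?thesis
    using cube_emb_zero assms(1) pull_id[of u] by (auto simp: vertices_def)
qed

lemma cell_eq_cdim:
  assumes "c \<in> cubes X" "d \<in> cubes X" "cell X c = cell X d"
  shows "cdim X c = cdim X d"
  using cell_eqD[OF assms(1,3)] assms cdim_pull by metis

text \<open>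
  A simplicial link yields a symmetry \<open>f\<close> of the cube, fixing the corner \<open>{}\<close>, which carries \<open>c\<close>
  to \<open>d\<close>, because both span the same simplex. As the sides agree one by one and are distinct,
  \<open>f\<close> fixes all axes and so is the identity.
\<close>

lemma cube_eqI_sides:
  assumes npc: "simplicial_link X (corner X c {})"
    and c: "c \<in> cubes X" and d: "d \<in> cubes X" and dim: "cdim X c = cdim X d"
    and cor: "corner X c {} = corner X d {}"
    and sides: "\<And>i. i < cdim X c \<Longrightarrow> side X c {} i = side X d {} i"
  shows "c = d"
proof -
  have "link_simplex X c = link_simplex X d"
    unfolding link_simplex_def using dim sides by auto
  then obtain f where f: "cube_emb (cdim X d) (cdim X c) f" "f {} = {}"
      "d = pull X (cdim X d) f c"
    using npc c d cor unfolding simplicial_link_def by metis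
  have inj: "inj_on (side X c {}) {..<cdim X c}"
    using npc c unfolding simplicial_link_def by blast
  have "f {i} = {i}" if i: "i < cdim X c" for i
  proof -
    have "card (f {i}) = 1"
      using cube_emb_dist[OF f(1), of "{i}" "{}"] f(2) i dim by auto
    then obtain j where j: "f {i} = {j}" using card_1_singletonE by blast
    have "j < cdim X c" using cube_emb_in[OF f(1), of "{i}"] i dim j by auto
    moreover have "side X d {} i = side X c {} j"
      using side_pull[OF c f(1), of "{}" i j] f i dim j by auto
    ultimately show ?thesis using sides[OF i] inj i j by (auto dest: inj_onD)
  qed
  then have "f = id_emb (cdim X c)"
    using cube_emb_fixing_axes f dim by metis
  then show ?thesis using f(3) pull_id[OF c] dim by simp
qed

end

section \<open>Parallel edges in weakly special complexes\<close>

definition parallel_arcs :: "'c cubical \<Rightarrow> 'c \<Rightarrow> 'c \<Rightarrow> bool" where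
  "parallel_arcs X e e' \<longleftrightarrow> equivclp (elem_parallel X) (cell X e) (cell X e')"

lemma parallel_arcs_refl: "parallel_arcs X e e"
  by (simp add: parallel_arcs_def)

lemma parallel_arcs_sym: "parallel_arcs X e e' \<Longrightarrow> parallel_arcs X e' e"
  unfolding parallel_arcs_def by (rule equivclp_sym)

lemma parallel_arcs_trans [trans]:
  "parallel_arcs X e e' \<Longrightarrow> parallel_arcs X e' e'' \<Longrightarrow> parallel_arcs X e e''"
  unfolding parallel_arcs_def by (rule equivclp_trans)

context cube_complex
begin

lemma square_sides_parallel:
  assumes "s \<in> squares X"
  shows "parallel_arcs X (side X s {} 0) (side X s {1} 0)"
    and "parallel_arcs X (side X s {} 1) (side X s {0} 1)"
proof -
  have opposite: "parallel_arcs X (side X t {} 0) (side X t {1} 0)" if "t \<in> squares X" for t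
    using that unfolding parallel_arcs_def elem_parallel_def by blast
  show "parallel_arcs X (side X s {} 0) (side X s {1} 0)"
    using opposite[OF assms] .
  have s: "s \<in> cubes X" "cdim X s = 2" using assms by (auto simp: squares_def)
  let ?t = "pull X 2 swap_emb s"
  have emb: "cube_emb 2 (cdim X s) swap_emb" using cube_emb_swap s by simp
  have t: "?t \<in> squares X"
    unfolding squares_def using pull_closed[OF s(1) emb] by blast
  have sw: "swap_emb {} = {}" "swap_emb {0} = {1}" "swap_emb {1} = {0}" "swap_emb {0, 1} = {0, 1}"
    by (auto simp: swap_emb_def)
  have sd: "sym_diff {1} {0} = {0, 1::nat}" "sym_diff {0} {1} = {0, 1::nat}" by auto
  have "side X ?t {} 0 = side X s {} 1"
    using side_pull[OF s(1) emb, of "{}" 0 1] sw by simp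
  moreover have "side X ?t {1} 0 = side X s {0} 1"
    using side_pull[OF s(1) emb, of "{1}" 0 1] by (simp only: sw sd) simp
  ultimately show "parallel_arcs X (side X s {} 1) (side X s {0} 1)"
    using opposite[OF t] by simp
qed

text \<open>
  Two different edges of one hyperplane at a common vertex either form the corner of a square, a
  self-intersection, or do not, a self-osculation. If the edges are the same, the orientations can
  differ only on a loop, which is also a self-osculation.
\<close>

lemma weakly_special_parallel_arcs_eq:
  assumes ws: "weakly_special X" and e: "e \<in> arcs X" and e': "e' \<in> arcs X"
    and src: "src X e = src X e'" and par: "parallel_arcs X e e'"
  shows "e = e'"
proof -
  define H where "H = {F. equivclp (elem_parallel X) (cell X e) F}"
  have "H \<in> hyperplanes X" using e unfolding hyperplanes_def H_def edges_def by blast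
  then have H: "\<not> self_intersects X H" "\<not> self_osculates X H"
    using ws by (auto simp: weakly_special_def)
  have in_H: "cell X e \<in> H" "cell X e' \<in> H"
    using par by (auto simp: H_def parallel_arcs_def)
  have cubes: "e \<in> cubes X" "e' \<in> cubes X" "cdim X e = 1" "cdim X e' = 1"
    using e e' by (auto simp: arcs_def)
  have "incident X (cell X e) (src X e)" "incident X (cell X e') (src X e)"
    using self_in_cell cubes src unfolding incident_def by auto
  then have "cell X e' = cell X e"
    using H in_H src_vertex[OF e] unfolding self_intersects_def self_osculates_def by metis
  then obtain f where f: "cube_emb 1 1 f" "e' = pull X 1 f e"
    using cell_eqD[OF cubes(2)] cubes by metis
  have "src X e' = corner X e (f {})"
    unfolding src_def f(2) using corner_pull[OF cubes(1), of 1 f "{}"] f(1) cubes by simp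
  moreover have "src X e \<noteq> tgt X e"
    using H(2) in_H(1) self_in_cell[OF cubes(1)] unfolding self_osculates_def by blast
  ultimately have "f {} \<noteq> {0}" using src unfolding tgt_def by metis
  then have "f = id_emb 1" using cube_emb_one_one[OF f(1)] by blast
  then show ?thesis using f(2) pull_id[OF cubes(1)] cubes by metis
qed

text \<open>
  The rigidity behind everything that follows: a cube can be recovered from one corner and the
  hyperplanes dual to its sides at that corner.
\<close>

lemma weakly_special_cube_eqI:
  assumes ws: "weakly_special X" and c: "c \<in> cubes X" and d: "d \<in> cubes X"
    and dim: "cdim X c = cdim X d" and cor: "corner X c {} = corner X d {}"
    and par: "\<And>i. i < cdim X c \<Longrightarrow> parallel_arcs X (side X c {} i) (side X d {} i)"
  shows "c = d"
proof (rule cube_eqI_sides[OF _ c d dim cor])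
  show "simplicial_link X (corner X c {})"
    using ws corner_vertex[OF c] by (auto simp: weakly_special_def nonpositively_curved_def)
  show "side X c {} i = side X d {} i" if "i < cdim X c" for i
    using weakly_special_parallel_arcs_eq[OF ws side_arc side_arc _ par[OF that]]
      src_side c d dim cor that by simp
qed

end

lemma cubical_map_corner:
  assumes "cubical_map Y p X" "c \<in> cubes Y" "v \<subseteq> {..<cdim Y c}"
  shows "p (corner Y c v) = corner X (p c) v"
  unfolding corner_def using assms cube_emb_corner[OF assms(3)] unfolding cubical_map_def by blast

lemma cubical_map_side:
  assumes "cubical_map Y p X" "c \<in> cubes Y" "v \<subseteq> {..<cdim Y c}" "i < cdim Y c"
  shows "p (side Y c v i) = side X (p c) v i"
  unfolding side_def using assms cube_emb_side[OF assms(3,4)] unfolding cubical_map_def by blast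

lemma cubical_map_arc:
  assumes "cubical_map Y p X" "e \<in> arcs Y"
  shows "p e \<in> arcs X" "src X (p e) = p (src Y e)" "tgt X (p e) = p (tgt Y e)"
    "p (rev_arc Y e) = rev_arc X (p e)"
proof -
  have e: "e \<in> cubes Y" "cdim Y e = 1" using assms by (auto simp: arcs_def)
  show "p e \<in> arcs X" using assms(1) e by (auto simp: arcs_def cubical_map_def)
  show "src X (p e) = p (src Y e)" "tgt X (p e) = p (tgt Y e)"
    unfolding src_def tgt_def using cubical_map_corner[OF assms(1) e(1)] e(2) by simp_all
  show "p (rev_arc Y e) = rev_arc X (p e)"
    unfolding rev_arc_def
    using assms(1) e cube_emb_rev unfolding cubical_map_def by simp
qed

lemma cubical_map_vertex: "cubical_map Y p X \<Longrightarrow> v \<in> vertices Y \<Longrightarrow> p v \<in> vertices X"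
  by (auto simp: cubical_map_def vertices_def)

lemma cubical_map_cell:
  assumes "cubical_map Y p X" "c \<in> cubes Y"
  shows "p ` cell Y c = cell X (p c)"
proof -
  have "p (pull Y (cdim Y c) f c) = pull X (cdim Y c) f (p c)" if "cube_emb (cdim Y c) (cdim Y c) f" for f
    using assms that by (auto simp: cubical_map_def)
  moreover have "cdim X (p c) = cdim Y c" using assms by (auto simp: cubical_map_def)
  ultimately show ?thesis
    unfolding cell_def setcompr_eq_image image_image by (intro image_cong) simp_all
qed

lemma cubical_map_elem_parallel:
  assumes "cube_complex Y" "cubical_map Y p X" "elem_parallel Y E F"
  shows "elem_parallel X (p ` E) (p ` F)"
proof -
  interpret Y: cube_complex Y by fact
  obtain s where s: "s \<in> squares Y" "E = cell Y (side Y s {} 0)" "F = cell Y (side Y s {1} 0)"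
    using assms(3) by (auto simp: elem_parallel_def)
  then have s': "s \<in> cubes Y" "cdim Y s = 2" by (auto simp: squares_def)
  have "side Y s {} 0 \<in> cubes Y" "side Y s {1} 0 \<in> cubes Y"
    using Y.side_arc[of s] s' by (auto simp: arcs_def)
  then have "p ` E = cell X (side X (p s) {} 0)" "p ` F = cell X (side X (p s) {1} 0)"
    using s s' cubical_map_cell[OF assms(2)] cubical_map_side[OF assms(2), of s] by auto
  moreover have "p s \<in> squares X"
    using s' assms(2) by (auto simp: squares_def cubical_map_def)
  ultimately show ?thesis by (auto simp: elem_parallel_def)
qed

lemma cubical_map_parallel_arcs:
  assumes Y: "cube_complex Y" and p: "cubical_map Y p X" and e: "e \<in> arcs Y" "e' \<in> arcs Y"
    and par: "parallel_arcs Y e e'"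
  shows "parallel_arcs X (p e) (p e')"
proof -
  have "equivclp (elem_parallel X) (p ` cell Y e) (p ` cell Y e')"
    using par unfolding parallel_arcs_def
  proof (induction rule: equivclp_induct)
    case (step E F)
    then show ?case
      using cubical_map_elem_parallel[OF Y p] equivclp_into_equivclp by metis
  qed simp
  then show ?thesis
    using cubical_map_cell[OF p] e by (auto simp: parallel_arcs_def arcs_def)
qed

section \<open>Lifting edge paths\<close>

definition rev_path :: "'c cubical \<Rightarrow> 'c list \<Rightarrow> 'c list" where
  "rev_path X es = rev (map (rev_arc X) es)"

lemma edge_path_arcs: "edge_path X u es v \<Longrightarrow> set es \<subseteq> arcs X"
  by (induction es arbitrary: u) auto

lemma edge_path_end_unique: "edge_path X u es v \<Longrightarrow> edge_path X u es w \<Longrightarrow> v = w"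
  by (induction es arbitrary: u) auto

context cube_complex
begin

lemma edge_path_vertices: "edge_path X u es v \<Longrightarrow> u \<in> vertices X \<and> v \<in> vertices X"
  by (induction es arbitrary: u) (auto intro: src_vertex)

lemma edge_path_append:
  "edge_path X u (es @ fs) w \<longleftrightarrow> (\<exists>v. edge_path X u es v \<and> edge_path X v fs w)"
  by (induction es arbitrary: u) (auto dest: edge_path_vertices)

lemma edge_path_rev: "edge_path X u es v \<Longrightarrow> edge_path X v (rev_path X es) u"
  by (induction es arbitrary: u)
    (auto simp: rev_path_def edge_path_append rev_arc_facts src_vertex)

end

lemma cubical_map_edge_path:
  "cubical_map Y p X \<Longrightarrow> edge_path Y u es v \<Longrightarrow> edge_path X (p u) (map p es) (p v)"
  by (induction es arbitrary: u) (auto simp: cubical_map_arc cubical_map_vertex)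

lemma cubical_map_rev_path:
  "cubical_map Y p X \<Longrightarrow> set es \<subseteq> arcs Y \<Longrightarrow> map p (rev_path Y es) = rev_path X (map p es)"
  by (auto simp: rev_path_def rev_map cubical_map_arc subset_iff)

locale covering = Y: cube_complex Y + X: cube_complex X
  for Y :: "'a cubical" and X :: "'b cubical" +
  fixes p :: "'a \<Rightarrow> 'b"
  assumes covering: "covering_map_of Y p X"
begin

lemma cubical: "cubical_map Y p X"
  using covering by (simp add: covering_map_of_def)

lemma lift_exists:
  assumes "v \<in> vertices Y" "c \<in> cubes X" "corner X c {} = p v"
  shows "\<exists>d\<in>cubes Y. corner Y d {} = v \<and> p d = c"
  using covering assms unfolding covering_map_of_def by blast

lemma lift_unique:
  assumes "c \<in> cubes Y" "d \<in> cubes Y" "corner Y c {} = corner Y d {}" "p c = p d"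
  shows "c = d"
proof -
  have "corner Y c {} \<in> vertices Y" "p c \<in> cubes X"
    using Y.corner_vertex assms(1) cubical by (auto simp: cubical_map_def)
  moreover have "corner X (p c) {} = p (corner Y c {})"
    using cubical_map_corner[OF cubical assms(1)] by simp
  ultimately have "\<exists>!d. d \<in> cubes Y \<and> corner Y d {} = corner Y c {} \<and> p d = p c"
    using covering unfolding covering_map_of_def by blast
  then show ?thesis using assms by metis
qed

lemma arc_lift_exists:
  assumes "v \<in> vertices Y" "e \<in> arcs X" "src X e = p v"
  shows "\<exists>e'\<in>arcs Y. src Y e' = v \<and> p e' = e"
proof -
  obtain d where d: "d \<in> cubes Y" "corner Y d {} = v" "p d = e"
    using lift_exists[OF assms(1), of e] assms by (auto simp: arcs_def src_def)
  moreover have "cdim Y d = cdim X (p d)" using d cubical by (auto simp: cubical_map_def)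
  ultimately show ?thesis using assms(2) by (auto simp: arcs_def src_def)
qed

lemma arc_lift_unique:
  assumes "e \<in> arcs Y" "e' \<in> arcs Y" "src Y e = src Y e'" "p e = p e'"
  shows "e = e'"
  using lift_unique[of e e'] assms by (auto simp: arcs_def src_def)

lemma path_lift:
  assumes "edge_path X (p v) es w" "v \<in> vertices Y"
  shows "\<exists>fs u. edge_path Y v fs u \<and> map p fs = es"
  using assms
proof (induction es arbitrary: v)
  case Nil
  then show ?case by (intro exI[of _ "[]"]) simp
next
  case (Cons e es)
  then obtain e' where e': "e' \<in> arcs Y" "src Y e' = v" "p e' = e"
    using arc_lift_exists[of v e] by auto
  then have "edge_path X (p (tgt Y e')) es w" "tgt Y e' \<in> vertices Y"
    using Cons.prems cubical_map_arc[OF cubical e'(1)] Y.tgt_vertex by auto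
  then obtain fs u where "edge_path Y (tgt Y e') fs u" "map p fs = es"
    using Cons.IH by blast
  then show ?case using e' by (intro exI[of _ "e' # fs"] exI[of _ u]) simp
qed

text \<open>
  The local part of homotopy lifting. An elementary homotopy replaces a subpath \<open>\<alpha>\<close> by \<open>\<beta>\<close>. If every
  lift of the projection of \<open>\<alpha>\<close>, started in the right fibre, can be traded for a lift of the
  projection of \<open>\<beta>\<close> with the same ends, then the same holds for the whole path.
\<close>

lemma replace_subpath_lift:
  assumes ep: "edge_path Y u (E @ \<alpha> @ F) v" "edge_path Y u (E @ \<beta> @ F) v"
    and loc: "\<And>s s' z z' \<gamma>. edge_path Y s \<alpha> s' \<Longrightarrow> edge_path Y s \<beta> s' \<Longrightarrow> p z = p s \<Longrightarrow>
        edge_path Y z \<gamma> z' \<Longrightarrow> map p \<gamma> = map p \<alpha> \<Longrightarrow>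
        \<exists>\<gamma>'. edge_path Y z \<gamma>' z' \<and> map p \<gamma>' = map p \<beta>"
    and gs: "edge_path Y b gs w" "map p gs = map p (E @ \<alpha> @ F)" "p b = p u"
  shows "\<exists>hs. edge_path Y b hs w \<and> map p hs = map p (E @ \<beta> @ F)"
proof -
  obtain s s' where s: "edge_path Y u E s" "edge_path Y s \<alpha> s'" "edge_path Y s' F v"
    using ep(1) by (auto simp: Y.edge_path_append)
  obtain t t' where t: "edge_path Y u E t" "edge_path Y t \<beta> t'" "edge_path Y t' F v"
    using ep(2) by (auto simp: Y.edge_path_append)
  have st: "s = t" using s t edge_path_end_unique by metis
  \<comment> \<open>The end of a path and its list of edges determine its start as well.\<close>
  have F_inj: "a = a'" if "edge_path Y a F v" "edge_path Y a' F v" for a a'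
    using that by (cases F) auto
  have st': "s' = t'" using F_inj s t by metis
  obtain G1 \<gamma> G3 where G: "gs = G1 @ \<gamma> @ G3" "map p G1 = map p E" "map p \<gamma> = map p \<alpha>"
      "map p G3 = map p F"
    using gs(2) unfolding map_append map_eq_append_conv eq_commute[of "map p _ @ map p _"] by metis
  obtain z z' where z: "edge_path Y b G1 z" "edge_path Y z \<gamma> z'" "edge_path Y z' G3 w"
    using gs(1) G(1) by (auto simp: Y.edge_path_append)
  have "p z = p s"
    using cubical_map_edge_path[OF cubical z(1)] cubical_map_edge_path[OF cubical s(1)]
      G(2) gs(3) edge_path_end_unique by metis
  then obtain \<gamma>' where "edge_path Y z \<gamma>' z'" "map p \<gamma>' = map p \<beta>"
    using loc[OF s(2) _ _ z(2) G(3)] t(2) st st' by auto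
  then have "edge_path Y b (G1 @ \<gamma>' @ G3) w \<and> map p (G1 @ \<gamma>' @ G3) = map p (E @ \<beta> @ F)"
    using z G by (auto simp: Y.edge_path_append)
  then show ?thesis by blast
qed

lemma backtrack_lift:
  assumes e: "e \<in> arcs Y" and \<gamma>: "edge_path Y z \<gamma> z'" "map p \<gamma> = map p [e, rev_arc Y e]"
  shows "z' = z"
proof -
  obtain e1 e2 where "\<gamma> = [e1, e2]" and pe: "p e1 = p e" "p e2 = p (rev_arc Y e)"
    using \<gamma>(2) by auto
  then have e12: "e1 \<in> arcs Y" "e2 \<in> arcs Y" "src Y e1 = z" "src Y e2 = tgt Y e1" "z' = tgt Y e2"
    using \<gamma>(1) by auto
  have "src Y e2 = src Y (rev_arc Y e1)"
    using Y.rev_arc_facts(2)[OF e12(1)] e12(4) by simp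
  moreover have "p e2 = p (rev_arc Y e1)"
    using pe cubical_map_arc(4)[OF cubical e] cubical_map_arc(4)[OF cubical e12(1)] by simp
  ultimately have "e2 = rev_arc Y e1"
    using arc_lift_unique e12(2) Y.rev_arc_facts(1)[OF e12(1)] by blast
  then show ?thesis using e12 Y.rev_arc_facts[OF e12(1)] by simp
qed

text \<open>
  The lift of the square \<open>s\<close> at \<open>z\<close> contains both the given lift of one half of its boundary, by
  uniqueness of lifts, and the required lift of the other half. The roles of the two directions are
  symmetric, so that the one argument serves for both directions of the homotopy.
\<close>

lemma square_lift:
  assumes s: "s \<in> squares Y" and ij: "{i, j} = {0, 1}"
    and z: "p z = p (corner Y s {})"
    and \<gamma>: "edge_path Y z \<gamma> z'" "map p \<gamma> = map p [side Y s {} i, side Y s {i} j]"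
  shows "\<exists>\<gamma>'. edge_path Y z \<gamma>' z' \<and> map p \<gamma>' = map p [side Y s {} j, side Y s {j} i]"
proof -
  have s': "s \<in> cubes Y" "cdim Y s = 2" using s by (auto simp: squares_def)
  have lt: "i < 2" "j < 2" "i \<noteq> j" using ij by (auto simp: doubleton_eq_iff)
  have zv: "z \<in> vertices Y" using \<gamma>(1) Y.edge_path_vertices by blast
  have "p s \<in> cubes X" using s' cubical by (auto simp: cubical_map_def)
  moreover have "corner X (p s) {} = p z"
    using cubical_map_corner[OF cubical s'(1), of "{}"] z by simp
  ultimately obtain t where t: "t \<in> cubes Y" "corner Y t {} = z" "p t = p s"
    using lift_exists[OF zv] by blast
  have t2: "cdim Y t = 2" using t s' cubical by (metis cubical_map_def)
  have side: "p (side Y t v k) = p (side Y s v k)" if "v \<subseteq> {..<2}" "k < 2" for v k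
    using cubical_map_side[OF cubical t(1)] cubical_map_side[OF cubical s'(1)] that t2 t(3) s'(2)
    by simp
  have arc: "side Y t v k \<in> arcs Y" "src Y (side Y t v k) = corner Y t v"
    "tgt Y (side Y t v k) = corner Y t (sym_diff v {k})" if "v \<subseteq> {..<2}" "k < 2" for v k
    using Y.side_arc[OF t(1)] Y.src_side[OF t(1)] Y.tgt_side[OF t(1)] that t2 by auto
  obtain e1 e2 where e: "\<gamma> = [e1, e2]" "p e1 = p (side Y s {} i)" "p e2 = p (side Y s {i} j)"
    using \<gamma>(2) by auto
  then have e12: "e1 \<in> arcs Y" "e2 \<in> arcs Y" "src Y e1 = z" "src Y e2 = tgt Y e1" "z' = tgt Y e2"
    using \<gamma>(1) by auto
  have "src Y e1 = src Y (side Y t {} i)" "p e1 = p (side Y t {} i)"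
    using arc(2)[of "{}" i] e12(3) lt(1) t(2) e(2) side[of "{}" i] by simp_all
  then have "e1 = side Y t {} i"
    using arc_lift_unique e12(1) arc(1)[of "{}" i] lt(1) by blast
  then have "tgt Y e1 = corner Y t {i}" using arc(3)[of "{}" i] lt by simp
  then have "src Y e2 = src Y (side Y t {i} j)" "p e2 = p (side Y t {i} j)"
    using arc(2)[of "{i}" j] e12(4) lt e(3) side[of "{i}" j] by simp_all
  then have "e2 = side Y t {i} j"
    using arc_lift_unique e12(2) arc(1)[of "{i}" j] lt by blast
  then have "z' = corner Y t (sym_diff {i} {j})" using arc(3)[of "{i}" j] lt e12(5) by simp
  moreover have "sym_diff {i} {j} = sym_diff {j} {i}" by blast
  ultimately have "edge_path Y z [side Y t {} j, side Y t {j} i] z'"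
    using arc[of "{}" j] arc[of "{j}" i] lt t Y.tgt_vertex[of "side Y t {j} i"] by auto
  then show ?thesis using side lt by (intro exI[of _ "[side Y t {} j, side Y t {j} i]"]) auto
qed

lemma elem_homotopic_lift:
  assumes hom: "elem_homotopic Y es fs"
    and ep: "edge_path Y u es v" "edge_path Y u fs v" and b: "p b = p u"
  shows "edge_path Y b gs w \<Longrightarrow> map p gs = map p es \<Longrightarrow>
      \<exists>hs. edge_path Y b hs w \<and> map p hs = map p fs"
    and "edge_path Y b gs w \<Longrightarrow> map p gs = map p fs \<Longrightarrow>
      \<exists>hs. edge_path Y b hs w \<and> map p hs = map p es"
proof -
  have "(\<forall>gs. edge_path Y b gs w \<and> map p gs = map p es \<longrightarrow>
          (\<exists>hs. edge_path Y b hs w \<and> map p hs = map p fs)) \<and>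
        (\<forall>gs. edge_path Y b gs w \<and> map p gs = map p fs \<longrightarrow>
          (\<exists>hs. edge_path Y b hs w \<and> map p hs = map p es))"
    using hom ep
  proof (cases rule: elem_homotopic.cases)
    case (backtrack e E F)
    have es: "es = E @ [e, rev_arc Y e] @ F" and fs: "fs = E @ [] @ F" using backtrack by auto
    have del: "\<exists>\<gamma>'. edge_path Y z \<gamma>' z' \<and> map p \<gamma>' = map p []"
      if "edge_path Y z \<gamma> z'" "map p \<gamma> = map p [e, rev_arc Y e]" for z z' \<gamma>
      using backtrack_lift[OF backtrack(3) that] that Y.edge_path_vertices by force
    have ins: "\<exists>\<gamma>'. edge_path Y z \<gamma>' z' \<and> map p \<gamma>' = map p [e, rev_arc Y e]"
      if s: "edge_path Y s [e, rev_arc Y e] s'" "p z = p s" "edge_path Y z \<gamma> z'" "map p \<gamma> = map p []"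
      for z z' \<gamma> s s'
    proof -
      have z: "z \<in> vertices Y" "z' = z" using s by auto
      obtain e1 where "e1 \<in> arcs Y" "src Y e1 = z" "p e1 = p e"
        using arc_lift_exists[OF z(1), of "p e"] s(1,2) cubical_map_arc[OF cubical backtrack(3)]
        by auto
      then show ?thesis
        using z Y.rev_arc_facts[of e1] cubical_map_arc(4)[OF cubical] backtrack(3)
        by (intro exI[of _ "[e1, rev_arc Y e1]"]) auto
    qed
    have "\<exists>hs. edge_path Y b hs w \<and> map p hs = map p (E @ [] @ F)"
      if "edge_path Y b gs w" "map p gs = map p (E @ [e, rev_arc Y e] @ F)" for gs
      by (rule replace_subpath_lift[OF ep[unfolded es fs] _ that b]) (rule del)
    moreover have "\<exists>hs. edge_path Y b hs w \<and> map p hs = map p (E @ [e, rev_arc Y e] @ F)"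
      if "edge_path Y b gs w" "map p gs = map p (E @ [] @ F)" for gs
      by (rule replace_subpath_lift[OF ep(2,1)[unfolded es fs] _ that b]) (rule ins)
    ultimately show ?thesis unfolding es fs by blast
  next
    case (square s E F)
    have "\<exists>hs. edge_path Y b hs w \<and> map p hs = map p (E @ [side Y s {} j, side Y s {j} i] @ F)"
      if ij: "{i, j} = {0, 1}"
        and eps: "edge_path Y u (E @ [side Y s {} i, side Y s {i} j] @ F) v"
          "edge_path Y u (E @ [side Y s {} j, side Y s {j} i] @ F) v"
        and gs: "edge_path Y b gs w"
          "map p gs = map p (E @ [side Y s {} i, side Y s {i} j] @ F)" for i j gs
    proof (rule replace_subpath_lift[OF eps _ gs b])
      fix t t' z z' \<gamma>
      assume t: "edge_path Y t [side Y s {} i, side Y s {i} j] t'" "p z = p t" "edge_path Y z \<gamma> z'"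
        "map p \<gamma> = map p [side Y s {} i, side Y s {i} j]"
      have s: "s \<in> cubes Y" "cdim Y s = 2" using square by (auto simp: squares_def)
      have "i < 2" using ij by (auto simp: doubleton_eq_iff)
      then have "corner Y s {} = t" using t(1) Y.src_side[OF s(1), of "{}" i] s by auto
      then show "\<exists>\<gamma>'. edge_path Y z \<gamma>' z' \<and> map p \<gamma>' = map p [side Y s {} j, side Y s {j} i]"
        using square_lift[OF square(3) ij _ t(3,4)] t(2) by simp
    qed
    from this[of 0 1] this[of 1 0] show ?thesis
      using ep unfolding square by (auto simp: insert_commute)
  qed
  then show "edge_path Y b gs w \<Longrightarrow> map p gs = map p es \<Longrightarrow>
      \<exists>hs. edge_path Y b hs w \<and> map p hs = map p fs"
    and "edge_path Y b gs w \<Longrightarrow> map p gs = map p fs \<Longrightarrow>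
      \<exists>hs. edge_path Y b hs w \<and> map p hs = map p es"
    by blast+
qed

text \<open>
  This is where simple connectedness enters. A loop of \<open>Y\<close> is contracted in \<open>Y\<close>, but the elementary
  homotopies are lifted after projection, at a vertex \<open>b\<close> of the same fibre, and there they
  connect the path \<open>gs\<close> to the constant path.
\<close>

lemma loop_lift_closed:
  assumes sc: "simply_connected_complex Y" and loop: "edge_path Y u es u"
    and gs: "edge_path Y b gs w" "map p gs = map p es" and b: "p b = p u"
  shows "w = b"
proof -
  have "homotopic_paths_in Y u u es []"
    using sc loop by (auto simp: simply_connected_complex_def)
  then have "\<exists>hs. edge_path Y b hs w \<and> map p hs = map p []"
    unfolding homotopic_paths_in_def
  proof (induction rule: equivclp_induct)
    case base
    then show ?case using gs by blast
  next
    case (step y z)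
    then obtain hs where hs: "edge_path Y b hs w" "map p hs = map p y" by blast
    from step.hyps(2) show ?case
    proof
      assume "edge_path Y u y u \<and> edge_path Y u z u \<and> elem_homotopic Y y z"
      then show ?thesis using elem_homotopic_lift(1)[OF _ _ _ b hs] by blast
    next
      assume "edge_path Y u z u \<and> edge_path Y u y u \<and> elem_homotopic Y z y"
      then show ?thesis using elem_homotopic_lift(2)[OF _ _ _ b hs] by blast
    qed
  qed
  then show ?thesis by auto
qed

end

section \<open>Deck transformations of the universal cover\<close>

lemma deck_groupD:
  assumes "g \<in> carrier (deck_group Y p)"
  shows "cubical_map Y g Y" "bij_betw g (cubes Y) (cubes Y)" "g \<in> extensional (cubes Y)"
    "\<And>c. c \<in> cubes Y \<Longrightarrow> p (g c) = p c"
  using assms by (auto simp: deck_group_def Bij_def)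

lemma deck_group_mult_apply:
  assumes "g \<in> carrier (deck_group Y p)" "h \<in> carrier (deck_group Y p)" "c \<in> cubes Y"
  shows "(g \<otimes>\<^bsub>deck_group Y p\<^esub> h) c = g (h c)"
  using assms by (simp add: deck_group_def BijGroup_def compose_eq)

lemma deck_group_inverse:
  assumes Y: "cube_complex Y" and g: "g \<in> carrier (deck_group Y p)"
  obtains h where "h \<in> carrier (deck_group Y p)"
    "\<And>c. c \<in> cubes Y \<Longrightarrow> h (g c) = c" "\<And>c. c \<in> cubes Y \<Longrightarrow> g (h c) = c"
proof -
  interpret G: group "deck_group Y p" by (rule group_deck_group[OF Y])
  have one: "\<one>\<^bsub>deck_group Y p\<^esub> c = c" if "c \<in> cubes Y" for c
    using that by (simp add: deck_group_def BijGroup_def)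
  let ?h = "inv\<^bsub>deck_group Y p\<^esub> g"
  have h: "?h \<in> carrier (deck_group Y p)" using g by simp
  show ?thesis
  proof (rule that[OF h])
    fix c assume c: "c \<in> cubes Y"
    show "?h (g c) = c" "g (?h c) = c"
      using deck_group_mult_apply[OF h g c] deck_group_mult_apply[OF g h c] g one[OF c]
      by simp_all
  qed
qed

context covering
begin

text \<open>
  The candidate for the graph, on vertices, of the deck transformation taking \<open>b1\<close> to \<open>b2\<close>: carry
  \<open>v\<close> along a path from \<open>b1\<close> to \<open>v\<close>, projected and lifted again at \<open>b2\<close>. The definition is symmetric in
  the two base points, so that well-definedness also gives the inverse.
\<close>

definition transported :: "'a \<Rightarrow> 'a \<Rightarrow> 'a \<Rightarrow> 'a \<Rightarrow> bool" where
  "transported b1 b2 v w \<longleftrightarrow>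
     (\<exists>fs gs. edge_path Y b1 fs v \<and> edge_path Y b2 gs w \<and> map p fs = map p gs)"

lemma transported_sym: "transported b1 b2 v w \<Longrightarrow> transported b2 b1 w v"
  unfolding transported_def by metis

lemma transported_project:
  assumes "p b1 = p b2" "transported b1 b2 v w"
  shows "p v = p w"
  using assms cubical_map_edge_path[OF cubical] edge_path_end_unique
  unfolding transported_def by metis

text \<open>
  Two paths from \<open>b1\<close> to \<open>v\<close> form a loop at \<open>v\<close>. Its projection lifts to a path from \<open>w\<close>
  to \<open>w'\<close>, which is closed by \<open>loop_lift_closed\<close>.
\<close>

lemma transported_unique:
  assumes sc: "simply_connected_complex Y" and b: "p b1 = p b2"
    and 1: "transported b1 b2 v w" and 2: "transported b1 b2 v w'"
  shows "w = w'"
proof -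
  obtain fs1 gs1 where 1: "edge_path Y b1 fs1 v" "edge_path Y b2 gs1 w" "map p fs1 = map p gs1"
    using 1 by (auto simp: transported_def)
  obtain fs2 gs2 where 2: "edge_path Y b1 fs2 v" "edge_path Y b2 gs2 w'" "map p fs2 = map p gs2"
    using 2 by (auto simp: transported_def)
  have "edge_path Y v (rev_path Y fs1 @ fs2) v"
    using Y.edge_path_rev[OF 1(1)] 2(1) by (auto simp: Y.edge_path_append)
  moreover have "edge_path Y w (rev_path Y gs1 @ gs2) w'"
    using Y.edge_path_rev[OF 1(2)] 2(2) by (auto simp: Y.edge_path_append)
  moreover have "map p (rev_path Y gs1 @ gs2) = map p (rev_path Y fs1 @ fs2)"
    using cubical_map_rev_path[OF cubical edge_path_arcs[OF 1(1)]]
      cubical_map_rev_path[OF cubical edge_path_arcs[OF 1(2)]] 1(3) 2(3) by simp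
  moreover have "p w = p v"
    using transported_project[OF b] 1 unfolding transported_def by metis
  ultimately show ?thesis using loop_lift_closed[OF sc] by blast
qed

lemma transported_step:
  assumes "transported b1 b2 (src Y e) (src Y e')" "e \<in> arcs Y" "e' \<in> arcs Y" "p e = p e'"
  shows "transported b1 b2 (tgt Y e) (tgt Y e')"
proof -
  obtain fs gs where "edge_path Y b1 fs (src Y e)" "edge_path Y b2 gs (src Y e')"
    "map p fs = map p gs"
    using assms(1) by (auto simp: transported_def)
  then have "edge_path Y b1 (fs @ [e]) (tgt Y e) \<and> edge_path Y b2 (gs @ [e']) (tgt Y e') \<and>
      map p (fs @ [e]) = map p (gs @ [e'])"
    using assms(2-4) Y.tgt_vertex by (auto simp: Y.edge_path_append)
  then show ?thesis unfolding transported_def by blast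
qed

lemma transported_corner:
  assumes c: "c \<in> cubes Y" and d: "d \<in> cubes Y" and pc: "p c = p d"
    and base: "transported b1 b2 (corner Y c {}) (corner Y d {})" and v: "v \<subseteq> {..<cdim Y c}"
  shows "transported b1 b2 (corner Y c v) (corner Y d v)"
proof -
  have dim: "cdim Y d = cdim Y c" using cubical c d pc by (metis cubical_map_def)
  have "finite v" using v finite_subset by blast
  then show ?thesis using v
  proof (induction v)
    case empty
    then show ?case using base by simp
  next
    case (insert i v)
    then have i: "i < cdim Y c" "v \<subseteq> {..<cdim Y c}" by auto
    have "sym_diff v {i} = insert i v" using insert by auto
    then have tgt: "tgt Y (side Y c v i) = corner Y c (insert i v)"
      "tgt Y (side Y d v i) = corner Y d (insert i v)"
      using Y.tgt_side[OF c i(2,1)] Y.tgt_side[OF d, of v i] i dim by simp_all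
    have "p (side Y c v i) = p (side Y d v i)"
      using cubical_map_side[OF cubical c] cubical_map_side[OF cubical d] i dim pc by simp
    moreover have "transported b1 b2 (src Y (side Y c v i)) (src Y (side Y d v i))"
      using insert.IH i dim Y.src_side[OF c] Y.src_side[OF d] by simp
    ultimately show ?case
      using transported_step[of b1 b2 "side Y c v i" "side Y d v i"] i dim
        Y.side_arc[OF c] Y.side_arc[OF d] unfolding tgt by simp
  qed
qed

lemma transported_cube_ex1:
  assumes sc: "simply_connected_complex Y" and b: "b1 \<in> vertices Y" "b2 \<in> vertices Y" "p b1 = p b2"
    and c: "c \<in> cubes Y"
  shows "\<exists>!d. d \<in> cubes Y \<and> p d = p c \<and> transported b1 b2 (corner Y c {}) (corner Y d {})"
proof (rule ex_ex1I)
  have v: "corner Y c {} \<in> vertices Y" using Y.corner_vertex[OF c] by simp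
  then obtain fs where fs: "edge_path Y b1 fs (corner Y c {})"
    using sc b unfolding simply_connected_complex_def connected_complex_def by blast
  then obtain gs w where gs: "edge_path Y b2 gs w" "map p gs = map p fs"
    using path_lift[of b2 "map p fs"] cubical_map_edge_path[OF cubical] b by metis
  have tr: "transported b1 b2 (corner Y c {}) w"
    unfolding transported_def using fs gs by metis
  have "corner X (p c) {} = p w"
    using transported_project[OF b(3) tr] cubical_map_corner[OF cubical c] by simp
  moreover have "p c \<in> cubes X" "w \<in> vertices Y"
    using c cubical gs Y.edge_path_vertices by (auto simp: cubical_map_def)
  ultimately show "\<exists>d. d \<in> cubes Y \<and> p d = p c \<and> transported b1 b2 (corner Y c {}) (corner Y d {})"
    using lift_exists tr by metis
next
  fix d d'
  assume "d \<in> cubes Y \<and> p d = p c \<and> transported b1 b2 (corner Y c {}) (corner Y d {})"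
    and "d' \<in> cubes Y \<and> p d' = p c \<and> transported b1 b2 (corner Y c {}) (corner Y d' {})"
  then show "d = d'" using transported_unique[OF sc b(3)] lift_unique by metis
qed

text \<open>
  The deck transformation taking \<open>b1\<close> to \<open>b2\<close>.
\<close>

definition transport :: "'a \<Rightarrow> 'a \<Rightarrow> 'a \<Rightarrow> 'a" where
  "transport b1 b2 = (\<lambda>c\<in>cubes Y.
     THE d. d \<in> cubes Y \<and> p d = p c \<and> transported b1 b2 (corner Y c {}) (corner Y d {}))"

lemma transport_props:
  assumes "simply_connected_complex Y" "b1 \<in> vertices Y" "b2 \<in> vertices Y" "p b1 = p b2" "c \<in> cubes Y"
  shows "transport b1 b2 c \<in> cubes Y" "p (transport b1 b2 c) = p c"
    "transported b1 b2 (corner Y c {}) (corner Y (transport b1 b2 c) {})"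
  using theI'[OF transported_cube_ex1[OF assms]] assms(5) by (simp_all add: transport_def)

lemma transport_eqI:
  assumes "simply_connected_complex Y" "b1 \<in> vertices Y" "b2 \<in> vertices Y" "p b1 = p b2" "c \<in> cubes Y"
    and "d \<in> cubes Y" "p d = p c" "transported b1 b2 (corner Y c {}) (corner Y d {})"
  shows "transport b1 b2 c = d"
  using transported_cube_ex1[OF assms(1-5)] transport_props[OF assms(1-5)] assms(6-8) by blast

lemma transport_inverse:
  assumes sc: "simply_connected_complex Y" and b: "b1 \<in> vertices Y" "b2 \<in> vertices Y" "p b1 = p b2"
    and c: "c \<in> cubes Y"
  shows "transport b2 b1 (transport b1 b2 c) = c"
proof -
  note tp = transport_props[OF sc b c]
  show ?thesis
    by (rule transport_eqI[OF sc b(2,1) b(3)[symmetric] tp(1) c])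
      (use tp transported_sym in simp_all)
qed

lemma transport_cubical:
  assumes sc: "simply_connected_complex Y" and b: "b1 \<in> vertices Y" "b2 \<in> vertices Y" "p b1 = p b2"
  shows "cubical_map Y (transport b1 b2) Y"
  unfolding cubical_map_def
proof (intro ballI conjI allI impI)
  fix c assume c: "c \<in> cubes Y"
  note tp = transport_props[OF sc b c]
  show "transport b1 b2 c \<in> cubes Y" by (rule tp)
  show dim: "cdim Y (transport b1 b2 c) = cdim Y c"
    using cubical c tp(1,2) by (metis cubical_map_def)
  fix m f assume f: "cube_emb m (cdim Y c) f"
  have f': "cube_emb m (cdim Y (transport b1 b2 c)) f" using f dim by simp
  show "transport b1 b2 (pull Y m f c) = pull Y m f (transport b1 b2 c)"
  proof (rule transport_eqI[OF sc b Y.pull_in[OF c f] Y.pull_in[OF tp(1) f']])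
    have "p (pull Y m f d) = pull X m f (p d)" if "d \<in> cubes Y" "cube_emb m (cdim Y d) f" for d
      using cubical that by (auto simp: cubical_map_def)
    then show "p (pull Y m f (transport b1 b2 c)) = p (pull Y m f c)"
      using c f tp f' by simp
    have "f {} \<subseteq> {..<cdim Y c}" using cube_emb_in[OF f] by simp
    then show "transported b1 b2 (corner Y (pull Y m f c) {}) (corner Y (pull Y m f (transport b1 b2 c)) {})"
      using transported_corner[OF c tp(1) tp(2)[symmetric] tp(3)]
        Y.corner_pull[OF c f, of "{}"] Y.corner_pull[OF tp(1) f', of "{}"] by simp
  qed
qed

lemma deck_group_transitive_on_fibres:
  assumes sc: "simply_connected_complex Y" and b: "b1 \<in> vertices Y" "b2 \<in> vertices Y" "p b1 = p b2"
  obtains g where "g \<in> carrier (deck_group Y p)" "g b1 = b2"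
proof -
  have "bij_betw (transport b1 b2) (cubes Y) (cubes Y)"
  proof (rule bij_betw_byWitness[where f' = "transport b2 b1"])
    show "\<forall>c\<in>cubes Y. transport b2 b1 (transport b1 b2 c) = c"
      "\<forall>c\<in>cubes Y. transport b1 b2 (transport b2 b1 c) = c"
      using transport_inverse[OF sc b] transport_inverse[OF sc b(2,1) b(3)[symmetric]] by auto
    show "transport b1 b2 ` cubes Y \<subseteq> cubes Y" "transport b2 b1 ` cubes Y \<subseteq> cubes Y"
      using transport_props(1)[OF sc b] transport_props(1)[OF sc b(2,1) b(3)[symmetric]] by auto
  qed
  moreover have "transport b1 b2 \<in> extensional (cubes Y)" by (simp add: transport_def)
  ultimately have "transport b1 b2 \<in> carrier (deck_group Y p)"
    using transport_cubical[OF sc b] transport_props(2)[OF sc b]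
    by (simp add: deck_group_def Bij_def)
  moreover have "transport b1 b2 b1 = b2"
  proof (rule transport_eqI[OF sc b])
    show "b1 \<in> cubes Y" "b2 \<in> cubes Y" "p b2 = p b1" using b by (auto simp: vertices_def)
    have "edge_path Y b1 [] b1" "edge_path Y b2 [] b2" using b by auto
    then have "transported b1 b2 b1 b2" unfolding transported_def by blast
    then show "transported b1 b2 (corner Y b1 {}) (corner Y b2 {})"
      using b by (simp add: Y.corner_of_vertex)
  qed
  ultimately show ?thesis by (rule that)
qed

text \<open>
  Agreement spreads from one vertex along edge paths, since lifts of edges are unique, and then from
  vertices to cubes.
\<close>

lemma deck_eqI:
  assumes con: "connected_complex Y"
    and g: "g \<in> carrier (deck_group Y p)" and h: "h \<in> carrier (deck_group Y p)"
    and v: "v \<in> vertices Y" "g v = h v"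
  shows "g = h"
proof (rule extensionalityI[OF deck_groupD(3)[OF g] deck_groupD(3)[OF h]])
  note gc = deck_groupD[OF g] and hc = deck_groupD[OF h]
  have along: "edge_path Y u es w \<Longrightarrow> g u = h u \<Longrightarrow> g w = h w" for u es w
  proof (induction es arbitrary: u)
    case (Cons e es)
    then have e: "e \<in> arcs Y" "src Y e = u" "edge_path Y (tgt Y e) es w" by auto
    note ge = cubical_map_arc[OF gc(1) e(1)] and he = cubical_map_arc[OF hc(1) e(1)]
    have "p (g e) = p (h e)" using gc(4) hc(4) e(1) by (simp add: arcs_def)
    then have "g e = h e" using arc_lift_unique ge he e(2) Cons.prems(2) by metis
    then show ?case using Cons.IH[OF e(3)] ge he by metis
  qed simp
  fix c assume c: "c \<in> cubes Y"
  have "corner Y c {} \<in> vertices Y" using Y.corner_vertex[OF c] by simp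
  then have "g (corner Y c {}) = h (corner Y c {})"
    using con v along unfolding connected_complex_def by blast
  then have "corner Y (g c) {} = corner Y (h c) {}"
    using cubical_map_corner[OF gc(1) c] cubical_map_corner[OF hc(1) c] by simp
  moreover have "p (g c) = p (h c)" using gc(4) hc(4) c by simp
  ultimately show "g c = h c"
    using lift_unique c gc(1) hc(1) by (auto simp: cubical_map_def)
qed

end

section \<open>Convex subcomplexes\<close>

text \<open>
  Connectedness by edge paths inside \<open>S\<close>, the form in which convexity enters inductions along paths.
  In contrast to convexity it is immediate for a single vertex.
\<close>

definition edge_connected :: "'c cubical \<Rightarrow> 'c set \<Rightarrow> bool" where
  "edge_connected X S \<longleftrightarrow>
     (\<forall>u\<in>S \<inter> vertices X. \<forall>v\<in>S \<inter> vertices X. \<exists>es. edge_path X u es v \<and> set es \<subseteq> S)"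

lemma edge_connected_induct:
  assumes "edge_connected X S" "u \<in> S \<inter> vertices X" "v \<in> S \<inter> vertices X" "Q u"
    and step: "\<And>e. e \<in> S \<Longrightarrow> e \<in> arcs X \<Longrightarrow> Q (src X e) \<Longrightarrow> Q (tgt X e)"
  shows "Q v"
proof -
  obtain es where "edge_path X u es v" "set es \<subseteq> S"
    using assms(1-3) unfolding edge_connected_def by blast
  then show ?thesis using \<open>Q u\<close>
  proof (induction es arbitrary: u)
    case (Cons e es)
    then show ?case using step[of e] by auto
  qed simp
qed

lemma subcomplexD:
  assumes "subcomplex X S" "c \<in> S"
  shows "c \<in> cubes X"
    and "cube_emb m (cdim X c) f \<Longrightarrow> pull X m f c \<in> S"
    and "v \<subseteq> {..<cdim X c} \<Longrightarrow> corner X c v \<in> S"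
    and "v \<subseteq> {..<cdim X c} \<Longrightarrow> i < cdim X c \<Longrightarrow> side X c v i \<in> S"
  using assms cube_emb_corner cube_emb_side unfolding subcomplex_def corner_def side_def by blast+

lemma subcomplex_arcD:
  assumes "subcomplex X S" "e \<in> S" "e \<in> arcs X"
  shows "src X e \<in> S" "tgt X e \<in> S"
  using subcomplexD(3)[OF assms(1,2)] assms(3) by (auto simp: src_def tgt_def arcs_def)

lemma convex_subcomplexD:
  assumes "convex_subcomplex X S"
  shows "subcomplex X S" "S \<noteq> {}" "S \<subseteq> cubes X"
    and "u \<in> S \<Longrightarrow> v \<in> S \<Longrightarrow> geodesic X u es v \<Longrightarrow> set es \<subseteq> S"
    and "c \<in> cubes X \<Longrightarrow> (\<And>u. u \<subseteq> {..<cdim X c} \<Longrightarrow> corner X c u \<in> S) \<Longrightarrow> c \<in> S"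
  using assms unfolding convex_subcomplex_def subcomplex_def by blast+

lemma convex_subcomplex_edge_connected:
  assumes con: "connected_complex X" and S: "convex_subcomplex X S"
  shows "edge_connected X S"
  unfolding edge_connected_def
proof (intro ballI)
  fix u v assume u: "u \<in> S \<inter> vertices X" and v: "v \<in> S \<inter> vertices X"
  then obtain es where "edge_path X u es v" using con unfolding connected_complex_def by blast
  then obtain fs where "geodesic X u fs v"
    using ex_has_least_nat[of "\<lambda>es. edge_path X u es v" es length] unfolding geodesic_def by blast
  then show "\<exists>es. edge_path X u es v \<and> set es \<subseteq> S"
    using convex_subcomplexD(4)[OF S] u v unfolding geodesic_def by blast
qed

lemma convex_subcomplex_arcI:
  assumes "convex_subcomplex X S" "e \<in> arcs X" "src X e \<in> S" "tgt X e \<in> S"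
  shows "e \<in> S"
proof (rule convex_subcomplexD(5)[OF assms(1)])
  show "e \<in> cubes X" using assms(2) by (simp add: arcs_def)
  fix u assume "u \<subseteq> {..<cdim X e}"
  then have "u \<in> Pow {..<1}" using assms(2) by (simp add: arcs_def)
  then show "corner X e u \<in> S"
    using assms(3,4) unfolding Pow_lessThan_one src_def tgt_def by blast
qed

lemma Hull_superset: "S \<subseteq> Hull X S"
  by (auto simp: Hull_def)

context cube_complex
begin

lemma convex_subcomplex_cubes: "cubes X \<noteq> {} \<Longrightarrow> convex_subcomplex X (cubes X)"
  unfolding convex_subcomplex_def subcomplex_def geodesic_def
  using pull_in edge_path_arcs by (fastforce simp: arcs_def)

lemma convex_subcomplex_Hull:
  assumes "S \<subseteq> cubes X" "S \<noteq> {}"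
  shows "convex_subcomplex X (Hull X S)"
proof -
  have mem: "c \<in> Hull X S" if "\<And>C. convex_subcomplex X C \<Longrightarrow> S \<subseteq> C \<Longrightarrow> c \<in> C" for c
    using that by (simp add: Hull_def)
  have memD: "c \<in> C" if "c \<in> Hull X S" "convex_subcomplex X C" "S \<subseteq> C" for c C
    using that by (auto simp: Hull_def)
  have "Hull X S \<subseteq> cubes X"
    using convex_subcomplex_cubes assms by (auto simp: Hull_def)
  moreover have "Hull X S \<noteq> {}" using Hull_superset[of S X] assms(2) by blast
  moreover have "pull X m f c \<in> Hull X S" if c: "c \<in> Hull X S" and f: "cube_emb m (cdim X c) f" for m f c
  proof (rule mem)
    fix C assume "convex_subcomplex X C" "S \<subseteq> C"
    then show "pull X m f c \<in> C"
      using subcomplexD(2)[OF convex_subcomplexD(1) _ f] memD[OF c] by blast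
  qed
  moreover have "set es \<subseteq> Hull X S"
    if uv: "u \<in> Hull X S" "v \<in> Hull X S" and es: "geodesic X u es v" for u v es
  proof
    fix e assume e: "e \<in> set es"
    show "e \<in> Hull X S"
    proof (rule mem)
      fix C assume "convex_subcomplex X C" "S \<subseteq> C"
      then show "e \<in> C"
        using convex_subcomplexD(4)[OF _ _ _ es] memD[OF uv(1)] memD[OF uv(2)] e by blast
    qed
  qed
  moreover have "c \<in> Hull X S"
    if c: "c \<in> cubes X" "\<forall>u\<in>Pow {..<cdim X c}. corner X c u \<in> Hull X S" for c
  proof (rule mem)
    fix C assume C: "convex_subcomplex X C" "S \<subseteq> C"
    have "corner X c u \<in> C" if "u \<subseteq> {..<cdim X c}" for u
      using c(2) that memD[OF _ C] by blast
    then show "c \<in> C" using convex_subcomplexD(5)[OF C(1) c(1)] by blast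
  qed
  ultimately show ?thesis unfolding convex_subcomplex_def subcomplex_def by blast
qed

text \<open>
  The hyperplanes of \<open>S\<close> are among those of \<open>T\<close> iff every edge of \<open>S\<close> is parallel to an edge of \<open>T\<close>, a
  condition that cubical maps respect.
\<close>

lemma hyperplanes_of_image_mono:
  assumes g: "cubical_map X g X" and S: "S \<subseteq> cubes X" and T: "T \<subseteq> cubes X"
    and sub: "hyperplanes_of X S \<subseteq> hyperplanes_of X T"
  shows "hyperplanes_of X (g ` S) \<subseteq> hyperplanes_of X (g ` T)"
proof
  fix H assume "H \<in> hyperplanes_of X (g ` S)"
  then obtain E s where E: "E \<in> edges X" "H = {F. equivclp (elem_parallel X) E F}"
    and s: "s \<in> S" "cdim X (g s) = 1" "equivclp (elem_parallel X) E (cell X (g s))"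
    unfolding hyperplanes_of_def hyperplanes_def by blast
  have s_arc: "s \<in> arcs X" using s S g by (auto simp: arcs_def cubical_map_def)
  let ?K = "{F. equivclp (elem_parallel X) (cell X s) F}"
  have "?K \<in> hyperplanes X" using s_arc unfolding hyperplanes_def edges_def by blast
  then have "?K \<in> hyperplanes_of X S"
    using s(1) s_arc unfolding hyperplanes_of_def arcs_def by auto
  then obtain t where t: "t \<in> T" "cdim X t = 1" "parallel_arcs X s t"
    using sub unfolding hyperplanes_of_def parallel_arcs_def by blast
  then have "parallel_arcs X (g s) (g t)"
    using cubical_map_parallel_arcs[OF cube_complex_axioms g s_arc] T by (auto simp: arcs_def)
  then have "cell X (g t) \<in> H"
    unfolding E(2) parallel_arcs_def using s(3) equivclp_trans by fastforce
  moreover have "H \<in> hyperplanes X" using E unfolding hyperplanes_def by blast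
  moreover have "cdim X (g t) = 1" using g t T by (auto simp: cubical_map_def)
  ultimately show "H \<in> hyperplanes_of X (g ` T)" using t(1) unfolding hyperplanes_of_def by blast
qed

lemma convex_subcomplex_image:
  assumes S: "convex_subcomplex X S"
    and g: "cubical_map X g X" and h: "cubical_map X h X"
    and inv: "\<And>c. c \<in> cubes X \<Longrightarrow> h (g c) = c" "\<And>c. c \<in> cubes X \<Longrightarrow> g (h c) = c"
  shows "convex_subcomplex X (g ` S)"
proof -
  note SD = convex_subcomplexD[OF S]
  have mem: "c \<in> g ` S" if "c \<in> cubes X" "h c \<in> S" for c
    using inv(2)[OF that(1)] that(2) by force
  have memD: "h c \<in> S \<and> c \<in> cubes X" if "c \<in> g ` S" for c
    using that inv(1) SD(3) g by (auto simp: cubical_map_def)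
  have "pull X m f c \<in> g ` S" if c: "c \<in> g ` S" and f: "cube_emb m (cdim X c) f" for c m f
  proof (rule mem)
    have "h (pull X m f c) = pull X m f (h c)" "cdim X (h c) = cdim X c"
      using h f memD[OF c] by (auto simp: cubical_map_def)
    then show "h (pull X m f c) \<in> S" using subcomplexD(2)[OF SD(1)] memD[OF c] f by simp
    show "pull X m f c \<in> cubes X" using pull_in memD[OF c] f by blast
  qed
  moreover have "set es \<subseteq> g ` S" if u: "u \<in> g ` S" "v \<in> g ` S" and es: "geodesic X u es v" for u v es
  proof -
    have ep: "edge_path X u es v" using es by (simp add: geodesic_def)
    have "geodesic X (h u) (map h es) (h v)"
      unfolding geodesic_def
    proof (intro conjI allI impI)
      show "edge_path X (h u) (map h es) (h v)" by (rule cubical_map_edge_path[OF h ep])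
      fix fs assume "edge_path X (h u) fs (h v)"
      then have "edge_path X u (map g fs) v"
        using cubical_map_edge_path[OF g] inv(2) memD u by metis
      then show "length (map h es) \<le> length fs" using es unfolding geodesic_def by fastforce
    qed
    then have "h ` set es \<subseteq> S" using SD(4) memD u by (metis list.set_map)
    then show ?thesis using mem edge_path_arcs[OF ep] by (auto simp: arcs_def)
  qed
  moreover have "c \<in> g ` S" if c: "c \<in> cubes X" "\<forall>u\<in>Pow {..<cdim X c}. corner X c u \<in> g ` S" for c
  proof (rule mem[OF c(1)], rule SD(5))
    show "h c \<in> cubes X" using h c by (simp add: cubical_map_def)
    have dim: "cdim X (h c) = cdim X c" using h c by (simp add: cubical_map_def)
    show "corner X (h c) u \<in> S" if "u \<subseteq> {..<cdim X (h c)}" for u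
    proof -
      have u: "u \<subseteq> {..<cdim X c}" using that dim by simp
      then have "corner X c u \<in> g ` S" using c(2) by blast
      then show ?thesis using memD cubical_map_corner[OF h c(1) u] by metis
    qed
  qed
  moreover have "g ` S \<noteq> {}" "g ` S \<subseteq> cubes X" using SD(2,3) g by (auto simp: cubical_map_def)
  ultimately show ?thesis unfolding convex_subcomplex_def subcomplex_def by blast
qed

end

section \<open>Cubical products\<close>

locale cubical_product = cube_complex X for X :: "'c cubical" +
  fixes A B :: "'c set" and x :: 'c and \<phi> :: "'c \<Rightarrow> 'c \<Rightarrow> 'c"
  assumes connected: "connected_complex X"
    and convex_A: "convex_subcomplex X A" and convex_B: "convex_subcomplex X B"
    and x_vertex: "x \<in> vertices X" and x_in_A: "x \<in> A" and x_in_B: "x \<in> B"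
    and product: "product_iso X A B x \<phi>"
begin

abbreviation "P \<equiv> Hull X (A \<union> B)"

lemma subcomplex_A: "subcomplex X A" and subcomplex_B: "subcomplex X B"
  using convex_subcomplexD(1) convex_A convex_B by blast+

lemma A_cubes: "a \<in> A \<Longrightarrow> a \<in> cubes X" and B_cubes: "b \<in> B \<Longrightarrow> b \<in> cubes X"
  using convex_subcomplexD(3)[OF convex_A] convex_subcomplexD(3)[OF convex_B] by auto

lemma convex_P: "convex_subcomplex X P"
  using convex_subcomplex_Hull A_cubes B_cubes x_in_A by (metis UnCI Un_iff empty_iff subsetI)

lemma P_cubes: "c \<in> P \<Longrightarrow> c \<in> cubes X"
  using convex_subcomplexD(3)[OF convex_P] by blast

lemma product_in: "a \<in> A \<Longrightarrow> b \<in> B \<Longrightarrow> \<phi> a b \<in> P"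
  and product_cdim: "a \<in> A \<Longrightarrow> b \<in> B \<Longrightarrow> cdim X (\<phi> a b) = cdim X a + cdim X b"
  and product_pull: "a \<in> A \<Longrightarrow> b \<in> B \<Longrightarrow> cube_emb m (cdim X a) f \<Longrightarrow> cube_emb n (cdim X b) g \<Longrightarrow>
    pull X (m + n) (emb_prod m n (cdim X a) f g) (\<phi> a b) = \<phi> (pull X m f a) (pull X n g b)"
  and product_surj: "c \<in> P \<Longrightarrow> \<exists>a\<in>A. \<exists>b\<in>B. cell X c = cell X (\<phi> a b)"
  and product_inj: "a \<in> A \<Longrightarrow> b \<in> B \<Longrightarrow> a' \<in> A \<Longrightarrow> b' \<in> B \<Longrightarrow> cell X (\<phi> a b) = cell X (\<phi> a' b') \<Longrightarrow>
    cell X a = cell X a' \<and> cell X b = cell X b'"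
  and product_x_right: "a \<in> A \<Longrightarrow> \<phi> a x = a"
  and product_x_left: "b \<in> B \<Longrightarrow> \<phi> x b = b"
  using product unfolding product_iso_def by blast+

lemma product_cubes: "a \<in> A \<Longrightarrow> b \<in> B \<Longrightarrow> \<phi> a b \<in> cubes X"
  using product_in P_cubes by blast

text \<open>
  Corners and sides of a product cube are computed by pulling back along products of a corner or side
  embedding with a corner embedding. The coordinates of \<open>b\<close> are shifted by the dimension of \<open>a\<close>.
\<close>

lemma product_corner:
  assumes "a \<in> A" "b \<in> B" "u \<subseteq> {..<cdim X a}" "v \<subseteq> {..<cdim X b}"
  shows "corner X (\<phi> a b) (u \<union> (+) (cdim X a) ` v) = \<phi> (corner X a u) (corner X b v)"
proof -
  have "emb_prod 0 0 (cdim X a) (corner_emb u) (corner_emb v) = corner_emb (u \<union> (+) (cdim X a) ` v)"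
    unfolding emb_prod_def add_0_left by (rule restrict_Pow_zero_eqI) simp
  then show ?thesis
    using product_pull[OF assms(1,2) cube_emb_corner[OF assms(3)] cube_emb_corner[OF assms(4)]]
    by (simp only: corner_def add_0_left)
qed

lemma product_side_left:
  assumes "a \<in> A" "b \<in> B" "u \<subseteq> {..<cdim X a}" "v \<subseteq> {..<cdim X b}" "i < cdim X a"
  shows "side X (\<phi> a b) (u \<union> (+) (cdim X a) ` v) i = \<phi> (side X a u i) (corner X b v)"
proof -
  have "sym_diff u {i} \<union> (+) (cdim X a) ` v = sym_diff (u \<union> (+) (cdim X a) ` v) {i}"
    using assms(5) by auto
  moreover have "(+) (1::nat) -` {} = {}" "(+) (1::nat) -` {0} = {}" by auto
  ultimately have "emb_prod 1 0 (cdim X a) (side_emb u i) (corner_emb v)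
      = side_emb (u \<union> (+) (cdim X a) ` v) i"
    unfolding emb_prod_def add_0_right by (intro restrict_Pow_one_eqI) simp_all
  then show ?thesis
    using product_pull[OF assms(1,2) cube_emb_side[OF assms(3,5)] cube_emb_corner[OF assms(4)]]
    by (simp only: corner_def side_def add_0_right)
qed

lemma product_side_right:
  assumes "a \<in> A" "b \<in> B" "u \<subseteq> {..<cdim X a}" "v \<subseteq> {..<cdim X b}" "j < cdim X b"
  shows "side X (\<phi> a b) (u \<union> (+) (cdim X a) ` v) (cdim X a + j) = \<phi> (corner X a u) (side X b v j)"
proof -
  have "u \<union> (+) (cdim X a) ` sym_diff v {j} = sym_diff (u \<union> (+) (cdim X a) ` v) {cdim X a + j}"
    using assms(3) by auto
  moreover have "(+) (0::nat) -` w = w" for w by auto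
  ultimately have "emb_prod 0 1 (cdim X a) (corner_emb u) (side_emb v j)
      = side_emb (u \<union> (+) (cdim X a) ` v) (cdim X a + j)"
    unfolding emb_prod_def add_0_left by (intro restrict_Pow_one_eqI) simp_all
  then show ?thesis
    using product_pull[OF assms(1,2) cube_emb_corner[OF assms(3)] cube_emb_side[OF assms(4,5)]]
    by (simp only: corner_def side_def add_0_left)
qed

lemma product_base_corner:
  "a \<in> A \<Longrightarrow> b \<in> B \<Longrightarrow> corner X (\<phi> a b) {} = \<phi> (corner X a {}) (corner X b {})"
  using product_corner[of a b "{}" "{}"] by simp

lemma product_arc_vertex:
  assumes "e \<in> A \<inter> arcs X" "b \<in> B \<inter> vertices X"
  shows "\<phi> e b \<in> arcs X" "src X (\<phi> e b) = \<phi> (src X e) b" "tgt X (\<phi> e b) = \<phi> (tgt X e) b"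
  using assms product_cubes[of e b] product_cdim[of e b] product_corner[of e b "{}" "{}"]
    product_corner[of e b "{0}" "{}"] corner_of_vertex[of b]
  by (auto simp: arcs_def vertices_def src_def tgt_def)

lemma product_vertex_arc:
  assumes "a \<in> A \<inter> vertices X" "f \<in> B \<inter> arcs X"
  shows "\<phi> a f \<in> arcs X" "src X (\<phi> a f) = \<phi> a (src X f)" "tgt X (\<phi> a f) = \<phi> a (tgt X f)"
  using assms product_cubes[of a f] product_cdim[of a f] product_corner[of a f "{}" "{}"]
    product_corner[of a f "{}" "{0}"] corner_of_vertex[of a]
  by (auto simp: arcs_def vertices_def src_def tgt_def)

text \<open>
  The square \<open>\<phi> e f\<close> has the edges \<open>\<phi> e v\<close> over the ends \<open>v\<close> of \<open>f\<close> as one pair of opposite sides,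
  and the edges \<open>\<phi> u f\<close> over the ends \<open>u\<close> of \<open>e\<close> as the other.
\<close>

lemma product_square:
  assumes e: "e \<in> A \<inter> arcs X" and f: "f \<in> B \<inter> arcs X"
  shows "parallel_arcs X (\<phi> e (src X f)) (\<phi> e (tgt X f))"
    and "parallel_arcs X (\<phi> (src X e) f) (\<phi> (tgt X e) f)"
proof -
  have e': "e \<in> A" "cdim X e = 1" and f': "f \<in> B" "cdim X f = 1"
    using e f by (auto simp: arcs_def)
  have s: "\<phi> e f \<in> squares X"
    using product_cubes[OF e'(1) f'(1)] product_cdim[OF e'(1) f'(1)] e' f' by (simp add: squares_def)
  have sides: "side X e {} 0 = e" "side X f {} 0 = f" using side_of_arc e f by auto
  have "side X (\<phi> e f) {} 0 = \<phi> e (src X f)" "side X (\<phi> e f) {1} 0 = \<phi> e (tgt X f)"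
    using product_side_left[OF e'(1) f'(1), of "{}" "{}" 0]
      product_side_left[OF e'(1) f'(1), of "{}" "{0}" 0] e' f' sides
    by (auto simp: src_def tgt_def)
  then show "parallel_arcs X (\<phi> e (src X f)) (\<phi> e (tgt X f))"
    using square_sides_parallel(1)[OF s] by simp
  have "side X (\<phi> e f) {} 1 = \<phi> (src X e) f" "side X (\<phi> e f) {0} 1 = \<phi> (tgt X e) f"
    using product_side_right[OF e'(1) f'(1), of "{}" "{}" 0]
      product_side_right[OF e'(1) f'(1), of "{0}" "{}" 0] e' f' sides
    by (auto simp: src_def tgt_def)
  then show "parallel_arcs X (\<phi> (src X e) f) (\<phi> (tgt X e) f)"
    using square_sides_parallel(2)[OF s] by simp
qed

lemma edge_connected_A: "edge_connected X A" and edge_connected_B: "edge_connected X B"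
  using convex_subcomplex_edge_connected[OF connected] convex_A convex_B by blast+

text \<open>
  Slide \<open>\<phi> e b\<close> across the squares along a path in \<open>B\<close> from \<open>b\<close> to \<open>x\<close>, where \<open>\<phi> e x = e\<close>.
\<close>

lemma product_arc_parallel_left:
  assumes e: "e \<in> A \<inter> arcs X" and b: "b \<in> B \<inter> vertices X"
  shows "parallel_arcs X (\<phi> e b) e"
proof -
  have "parallel_arcs X (\<phi> e b) (\<phi> e x)"
  proof (rule edge_connected_induct[OF edge_connected_B b, of x "\<lambda>v. parallel_arcs X (\<phi> e b) (\<phi> e v)"])
    show "x \<in> B \<inter> vertices X" using x_in_B x_vertex by blast
    show "parallel_arcs X (\<phi> e b) (\<phi> e b)" by (rule parallel_arcs_refl)
    fix f assume f: "f \<in> B" "f \<in> arcs X" and par: "parallel_arcs X (\<phi> e b) (\<phi> e (src X f))"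
    show "parallel_arcs X (\<phi> e b) (\<phi> e (tgt X f))"
      by (rule parallel_arcs_trans[OF par product_square(1)[OF e IntI[OF f]]])
  qed
  then show ?thesis using product_x_right e by simp
qed

lemma product_arc_parallel_right:
  assumes f: "f \<in> B \<inter> arcs X" and a: "a \<in> A \<inter> vertices X"
  shows "parallel_arcs X (\<phi> a f) f"
proof -
  have "parallel_arcs X (\<phi> a f) (\<phi> x f)"
  proof (rule edge_connected_induct[OF edge_connected_A a, of x "\<lambda>v. parallel_arcs X (\<phi> a f) (\<phi> v f)"])
    show "x \<in> A \<inter> vertices X" using x_in_A x_vertex by blast
    show "parallel_arcs X (\<phi> a f) (\<phi> a f)" by (rule parallel_arcs_refl)
    fix e assume e: "e \<in> A" "e \<in> arcs X" and par: "parallel_arcs X (\<phi> a f) (\<phi> (src X e) f)"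
    show "parallel_arcs X (\<phi> a f) (\<phi> (tgt X e) f)"
      by (rule parallel_arcs_trans[OF par product_square(2)[OF IntI[OF e] f]])
  qed
  then show ?thesis using product_x_left f by simp
qed

lemma product_side_parallel:
  assumes a: "a \<in> A" and b: "b \<in> B"
  shows "i < cdim X a \<Longrightarrow> parallel_arcs X (side X (\<phi> a b) {} i) (side X a {} i)"
    and "j < cdim X b \<Longrightarrow> parallel_arcs X (side X (\<phi> a b) {} (cdim X a + j)) (side X b {} j)"
proof -
  assume i: "i < cdim X a"
  have "side X a {} i \<in> A \<inter> arcs X" "corner X b {} \<in> B \<inter> vertices X"
    using subcomplexD[OF subcomplex_A a] subcomplexD[OF subcomplex_B b] side_arc corner_vertex i
    by auto
  then show "parallel_arcs X (side X (\<phi> a b) {} i) (side X a {} i)"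
    using product_side_left[OF a b, of "{}" "{}" i] i product_arc_parallel_left by simp
next
  assume j: "j < cdim X b"
  have "side X b {} j \<in> B \<inter> arcs X" "corner X a {} \<in> A \<inter> vertices X"
    using subcomplexD[OF subcomplex_A a] subcomplexD[OF subcomplex_B b] side_arc corner_vertex j
    by auto
  then show "parallel_arcs X (side X (\<phi> a b) {} (cdim X a + j)) (side X b {} j)"
    using product_side_right[OF a b, of "{}" "{}" j] j product_arc_parallel_right by simp
qed

lemma product_vertex_inj:
  assumes "a \<in> A \<inter> vertices X" "b \<in> B \<inter> vertices X" "a' \<in> A \<inter> vertices X" "b' \<in> B \<inter> vertices X"
    and "\<phi> a b = \<phi> a' b'"
  shows "a = a'" "b = b'"
proof -
  have "cell X a = cell X a'" "cell X b = cell X b'"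
    using product_inj[of a b a' b'] assms by auto
  then show "a = a'" "b = b'"
    using cell_vertex_inj[of a' a] cell_vertex_inj[of b' b] assms by (auto simp: vertices_def)
qed

text \<open>
  Surjectivity of \<open>\<phi>\<close> is given only up to a symmetry of the cube. For an edge of the product, one of the
  two factors is a vertex, and the symmetry can be absorbed into the other.
\<close>

lemma product_arc_cases:
  assumes "e \<in> P" "e \<in> arcs X"
  obtains (left) a b where "a \<in> A \<inter> arcs X" "b \<in> B \<inter> vertices X" "e = \<phi> a b"
    | (right) a b where "a \<in> A \<inter> vertices X" "b \<in> B \<inter> arcs X" "e = \<phi> a b"
proof -
  have e: "e \<in> cubes X" "cdim X e = 1" using assms(2) by (auto simp: arcs_def)
  obtain a b where ab: "a \<in> A" "b \<in> B" "cell X e = cell X (\<phi> a b)"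
    using product_surj[OF assms(1)] by blast
  have dim: "cdim X a + cdim X b = 1"
    using cell_eq_cdim[OF e(1) product_cubes[OF ab(1,2)] ab(3)] product_cdim[OF ab(1,2)] e(2) by simp
  then have "cdim X (\<phi> a b) = 1" using product_cdim[OF ab(1,2)] by simp
  then obtain k where k: "cube_emb 1 1 k" "e = pull X 1 k (\<phi> a b)"
    using cell_eqD[OF e(1) ab(3)] by metis
  have k_eqI: "F = k" if "F \<in> extensional (Pow {..<1})" "\<And>u. u \<subseteq> {..<1} \<Longrightarrow> F u = k u" for F
    using that k(1) by (intro extensionalityI[of F "Pow {..<1}" k]) (auto simp: cube_emb_def PiE_def)
  \<comment> \<open>A 1-cube is a product of an edge and a vertex; \<open>k\<close> is the symmetry to be moved to the edge.\<close>
  consider "cdim X a = 1" "cdim X b = 0" | "cdim X a = 0" "cdim X b = 1" using dim by linarith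
  then show ?thesis
  proof cases
    case 1
    have "emb_prod 1 0 1 k (id_emb 0) = k"
    proof (rule k_eqI)
      show "emb_prod 1 0 1 k (id_emb 0) \<in> extensional (Pow {..<1})" by (simp add: emb_prod_def)
      fix u :: "nat set" assume u: "u \<subseteq> {..<1}"
      then have "(+) 1 -` u = {}" "u \<inter> {..<1} = u" by auto
      then show "emb_prod 1 0 1 k (id_emb 0) u = k u" using u by (simp add: emb_prod_def)
    qed
    then have "e = \<phi> (pull X 1 k a) b"
      using product_pull[OF ab(1,2), of 1 k 0 "id_emb 0"] k 1 cube_emb_id pull_id[OF B_cubes[OF ab(2)]]
      by (simp only: add_0_right)
    moreover have "pull X 1 k a \<in> A \<inter> arcs X"
      using subcomplexD(2)[OF subcomplex_A ab(1)] pull_closed[OF A_cubes[OF ab(1)]] k(1) 1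
      by (auto simp: arcs_def)
    ultimately show ?thesis using left ab(2) B_cubes 1 by (auto simp: vertices_def)
  next
    case 2
    have "emb_prod 0 1 0 (id_emb 0) k = k"
    proof (rule k_eqI)
      show "emb_prod 0 1 0 (id_emb 0) k \<in> extensional (Pow {..<1})" by (simp add: emb_prod_def)
      fix u :: "nat set" assume u: "u \<subseteq> {..<1}"
      have "(+) 0 -` u = u" "(+) 0 ` k u = k u" by auto
      then show "emb_prod 0 1 0 (id_emb 0) k u = k u" using u by (simp add: emb_prod_def)
    qed
    then have "e = \<phi> a (pull X 1 k b)"
      using product_pull[OF ab(1,2), of 0 "id_emb 0" 1 k] k 2 cube_emb_id pull_id[OF A_cubes[OF ab(1)]]
      by (simp only: add_0_left)
    moreover have "pull X 1 k b \<in> B \<inter> arcs X"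
      using subcomplexD(2)[OF subcomplex_B ab(2)] pull_closed[OF B_cubes[OF ab(2)]] k(1) 2
      by (auto simp: arcs_def)
    ultimately show ?thesis using right ab(1) A_cubes 2 by (auto simp: vertices_def)
  qed
qed

end

section \<open>Rigidity of products under deck transformations\<close>

text \<open>
  Cubical maps from \<open>S\<close> to \<open>T\<close> over the base of \<open>p\<close>: restrictions of deck
  transformations, inclusions, and maps from one point of a fibre to another are examples.
\<close>

definition fibrewise_map :: "'a cubical \<Rightarrow> ('a \<Rightarrow> 'b) \<Rightarrow> 'a set \<Rightarrow> ('a \<Rightarrow> 'a) \<Rightarrow> 'a set \<Rightarrow> bool" where
  "fibrewise_map Y p S \<alpha> T \<longleftrightarrow>
     (\<forall>c\<in>S. \<alpha> c \<in> T \<and> p (\<alpha> c) = p c \<and>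
        (\<forall>m f. cube_emb m (cdim Y c) f \<longrightarrow> \<alpha> (pull Y m f c) = pull Y m f (\<alpha> c)))"

lemma fibrewise_map_arc:
  assumes "fibrewise_map Y p S \<alpha> T" "e \<in> S" "e \<in> arcs Y"
  shows "\<alpha> (src Y e) = src Y (\<alpha> e)" "\<alpha> (tgt Y e) = tgt Y (\<alpha> e)"
proof -
  have emb: "cube_emb 0 (cdim Y e) (corner_emb {})" "cube_emb 0 (cdim Y e) (corner_emb {0})"
    using assms(3) cube_emb_corner[of _ "cdim Y e"] by (simp_all add: arcs_def)
  then show "\<alpha> (src Y e) = src Y (\<alpha> e)" "\<alpha> (tgt Y e) = tgt Y (\<alpha> e)"
    using assms(1,2) unfolding fibrewise_map_def src_def tgt_def corner_def by blast+
qed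

lemma fibrewise_map_corner:
  assumes "fibrewise_map Y p S \<alpha> T" "c \<in> S"
  shows "\<alpha> (corner Y c {}) = corner Y (\<alpha> c) {}"
  using assms cube_emb_corner[of "{}" "cdim Y c"] unfolding fibrewise_map_def corner_def by blast

lemma fibrewise_map_id: "S \<subseteq> T \<Longrightarrow> fibrewise_map Y p S (\<lambda>c. c) T"
  by (auto simp: fibrewise_map_def)

lemma deck_fibrewise_map:
  assumes "g \<in> set_stabilizer (deck_group Y p) S" "S \<subseteq> cubes Y"
  shows "fibrewise_map Y p S g S"
  using assms deck_groupD(1,4)[of g Y p]
  unfolding fibrewise_map_def set_stabilizer_def cubical_map_def by blast

locale covered_product =
  covering Y X p + cubical_product Y A B x \<phi>
  for Y :: "'a cubical" and X :: "'b cubical" and p and A B x \<phi> +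
  assumes weakly_special: "weakly_special X"
begin

lemma p_cdim: "c \<in> cubes Y \<Longrightarrow> cdim X (p c) = cdim Y c"
  using cubical by (simp add: cubical_map_def)

lemma p_parallel: "e \<in> arcs Y \<Longrightarrow> e' \<in> arcs Y \<Longrightarrow> parallel_arcs Y e e' \<Longrightarrow> parallel_arcs X (p e) (p e')"
  by (rule cubical_map_parallel_arcs[OF Y.cube_complex_axioms cubical])

text \<open>
  By \<open>product_side_parallel\<close> each side of \<open>\<phi> a b\<close> is parallel to a side of \<open>a\<close> or of \<open>b\<close>, and the
  corresponding side of \<open>\<phi> a' b'\<close> to a side with the same image. So the images of both cubes have
  a corner and the hyperplanes at this corner in common.
\<close>

lemma product_image_eqI:
  assumes a: "a \<in> A" "a' \<in> A" "p a' = p a" and b: "b \<in> B" "b' \<in> B" "p b' = p b"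
    and base: "p (\<phi> (corner Y a {}) (corner Y b {})) = p (\<phi> (corner Y a' {}) (corner Y b' {}))"
  shows "p (\<phi> a b) = p (\<phi> a' b')"
proof (rule X.weakly_special_cube_eqI[OF weakly_special])
  have c: "\<phi> a b \<in> cubes Y" "\<phi> a' b' \<in> cubes Y" using product_cubes a b by blast+
  have dim: "cdim Y a' = cdim Y a" "cdim Y b' = cdim Y b"
    using p_cdim A_cubes B_cubes a b by metis+
  then have dim': "cdim Y (\<phi> a b) = cdim Y a + cdim Y b" "cdim Y (\<phi> a' b') = cdim Y a + cdim Y b"
    using product_cdim a b by simp_all
  show "p (\<phi> a b) \<in> cubes X" "p (\<phi> a' b') \<in> cubes X"
    using c cubical by (auto simp: cubical_map_def)
  show "cdim X (p (\<phi> a b)) = cdim X (p (\<phi> a' b'))" using p_cdim c dim' by simp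
  show "corner X (p (\<phi> a b)) {} = corner X (p (\<phi> a' b')) {}"
    using base a b
    by (simp add: product_base_corner cubical_map_corner[OF cubical c(1) empty_subsetI, symmetric]
        cubical_map_corner[OF cubical c(2) empty_subsetI, symmetric])
  fix i assume "i < cdim X (p (\<phi> a b))"
  then have i: "i < cdim Y a + cdim Y b" using p_cdim c dim' by simp
  have arcs: "side Y (\<phi> a b) {} i \<in> arcs Y" "side Y (\<phi> a' b') {} i \<in> arcs Y"
    using Y.side_arc c i dim' by simp_all
  have side_p: "p (side Y c {} k) = side X (p c) {} k" if "c \<in> cubes Y" "k < cdim Y c" for c k
    using cubical_map_side[OF cubical that(1) _ that(2)] by simp
  obtain e e' where e: "e \<in> arcs Y" "e' \<in> arcs Y" "p e = p e'"
    "parallel_arcs Y (side Y (\<phi> a b) {} i) e" "parallel_arcs Y (side Y (\<phi> a' b') {} i) e'"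
  proof (cases "i < cdim Y a")
    case True
    show ?thesis
    proof (rule that)
      show "side Y a {} i \<in> arcs Y" "side Y a' {} i \<in> arcs Y"
        using Y.side_arc A_cubes a True dim by simp_all
      show "p (side Y a {} i) = p (side Y a' {} i)"
        using side_p A_cubes a True dim by simp
      show "parallel_arcs Y (side Y (\<phi> a b) {} i) (side Y a {} i)"
        "parallel_arcs Y (side Y (\<phi> a' b') {} i) (side Y a' {} i)"
        using product_side_parallel(1) a b True dim by simp_all
    qed
  next
    case False
    define j where "j = i - cdim Y a"
    have j: "i = cdim Y a + j" "j < cdim Y b" using False i by (auto simp: j_def)
    show ?thesis
    proof (rule that)
      show "side Y b {} j \<in> arcs Y" "side Y b' {} j \<in> arcs Y"
        using Y.side_arc B_cubes b j(2) dim by simp_all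
      show "p (side Y b {} j) = p (side Y b' {} j)"
        using side_p B_cubes b j(2) dim by simp
      show "parallel_arcs Y (side Y (\<phi> a b) {} i) (side Y b {} j)"
        using product_side_parallel(2)[OF a(1) b(1) j(2)] j(1) by simp
      show "parallel_arcs Y (side Y (\<phi> a' b') {} i) (side Y b' {} j)"
        using product_side_parallel(2)[OF a(2) b(2), of j] j dim by simp
    qed
  qed
  have "parallel_arcs X (p (side Y (\<phi> a b) {} i)) (p e)"
    using p_parallel[OF arcs(1) e(1,4)] .
  also have "parallel_arcs X (p e) (p (side Y (\<phi> a' b') {} i))"
    using p_parallel[OF arcs(2) e(2,5)] e(3) parallel_arcs_sym by metis
  finally show "parallel_arcs X (side X (p (\<phi> a b)) {} i) (side X (p (\<phi> a' b')) {} i)"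
    using side_p c i dim' by simp
qed

lemma deck_product_cube:
  assumes g: "g \<in> carrier (deck_group Y p)"
    and a: "a \<in> A" "a' \<in> A" "p a' = p a" and b: "b \<in> B" "b' \<in> B" "p b' = p b"
    and base: "g (\<phi> (corner Y a {}) (corner Y b {})) = \<phi> (corner Y a' {}) (corner Y b' {})"
  shows "g (\<phi> a b) = \<phi> a' b'"
proof (rule lift_unique)
  note gD = deck_groupD[OF g]
  have c: "\<phi> a b \<in> cubes Y" using product_cubes a b by blast
  show "g (\<phi> a b) \<in> cubes Y" "\<phi> a' b' \<in> cubes Y"
    using gD(1) c product_cubes a b by (auto simp: cubical_map_def)
  show "corner Y (g (\<phi> a b)) {} = corner Y (\<phi> a' b') {}"
    using cubical_map_corner[OF gD(1) c, of "{}"] base a b by (simp add: product_base_corner)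
  have "corner Y (\<phi> a b) {} \<in> cubes Y" using Y.corner_vertex[OF c] by (auto simp: vertices_def)
  then have "\<phi> (corner Y a {}) (corner Y b {}) \<in> cubes Y" using a b by (simp add: product_base_corner)
  then have "p (\<phi> (corner Y a {}) (corner Y b {})) = p (\<phi> (corner Y a' {}) (corner Y b' {}))"
    using gD(4) base by metis
  then show "p (g (\<phi> a b)) = p (\<phi> a' b')"
    using product_image_eqI[OF a b] gD(4) c by simp
qed

text \<open>
  The central result. \<open>deck_product_cube\<close> propagates the equation from the base corner of a cube to the
  cube, and so to its other corners. Paths in \<open>B'\<close> and then in \<open>A'\<close> reach every corner. Subcomplexes
  \<open>A'\<close> and \<open>B'\<close> are admitted because a deck transformation need not map \<open>B\<close> into \<open>B\<close>; the equation can
  then still be applied to a single slice.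
\<close>

lemma deck_product_equivariant:
  assumes g: "g \<in> carrier (deck_group Y p)"
    and A': "subcomplex Y A'" "A' \<subseteq> A" "edge_connected Y A'" "fibrewise_map Y p A' \<alpha> A"
    and B': "subcomplex Y B'" "B' \<subseteq> B" "edge_connected Y B'" "fibrewise_map Y p B' \<beta> B"
    and base: "a0 \<in> A' \<inter> vertices Y" "b0 \<in> B' \<inter> vertices Y" "g (\<phi> a0 b0) = \<phi> (\<alpha> a0) (\<beta> b0)"
    and a: "a \<in> A'" and b: "b \<in> B'"
  shows "g (\<phi> a b) = \<phi> (\<alpha> a) (\<beta> b)"
proof -
  have cube: "g (\<phi> a b) = \<phi> (\<alpha> a) (\<beta> b)"
    if "a \<in> A'" "b \<in> B'"
      "g (\<phi> (corner Y a {}) (corner Y b {})) = \<phi> (\<alpha> (corner Y a {})) (\<beta> (corner Y b {}))" for a b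
  proof (rule deck_product_cube[OF g])
    show "a \<in> A" "\<alpha> a \<in> A" "p (\<alpha> a) = p a" "b \<in> B" "\<beta> b \<in> B" "p (\<beta> b) = p b"
      using that A' B' unfolding fibrewise_map_def by blast+
    show "g (\<phi> (corner Y a {}) (corner Y b {})) = \<phi> (corner Y (\<alpha> a) {}) (corner Y (\<beta> b) {})"
      using that(3) fibrewise_map_corner[OF A'(4) that(1)] fibrewise_map_corner[OF B'(4) that(2)]
      by simp
  qed
  note gD = deck_groupD[OF g]
  have ca: "corner Y a {} \<in> A' \<inter> vertices Y" and cb: "corner Y b {} \<in> B' \<inter> vertices Y"
    using subcomplexD(3)[OF A'(1) a] subcomplexD(3)[OF B'(1) b] Y.corner_vertex
      subcomplexD(1)[OF A'(1) a] subcomplexD(1)[OF B'(1) b] by auto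
  have "g (\<phi> a0 (corner Y b {})) = \<phi> (\<alpha> a0) (\<beta> (corner Y b {}))"
  proof (rule edge_connected_induct[OF B'(3) base(2) cb, of "\<lambda>v. g (\<phi> a0 v) = \<phi> (\<alpha> a0) (\<beta> v)"])
    show "g (\<phi> a0 b0) = \<phi> (\<alpha> a0) (\<beta> b0)" by fact
    fix f assume f: "f \<in> B'" "f \<in> arcs Y" and IH: "g (\<phi> a0 (src Y f)) = \<phi> (\<alpha> a0) (\<beta> (src Y f))"
    have a0: "a0 \<in> A'" "a0 \<in> A \<inter> vertices Y" and fB: "f \<in> B \<inter> arcs Y" using base(1) A'(2) B'(2) f by auto
    have "corner Y a0 {} = a0" using Y.corner_of_vertex a0 by blast
    then have eq: "g (\<phi> a0 f) = \<phi> (\<alpha> a0) (\<beta> f)"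
      using cube[OF a0(1) f(1)] IH by (simp add: src_def)
    have "p (\<alpha> a0) = p a0" "\<alpha> a0 \<in> A" "p (\<beta> f) = p f" "\<beta> f \<in> B"
      using A'(4) B'(4) a0(1) f(1) unfolding fibrewise_map_def by blast+
    then have \<alpha>\<beta>: "\<alpha> a0 \<in> A \<inter> vertices Y" "\<beta> f \<in> B \<inter> arcs Y"
      using a0 f p_cdim A_cubes B_cubes unfolding vertices_def arcs_def by (metis IntI IntD2 mem_Collect_eq)+
    have "g (\<phi> a0 (tgt Y f)) = tgt Y (g (\<phi> a0 f))"
      using product_vertex_arc[OF a0(2) fB] cubical_map_arc(3)[OF gD(1)] by metis
    also have "\<dots> = \<phi> (\<alpha> a0) (tgt Y (\<beta> f))"
      unfolding eq using product_vertex_arc(3)[OF \<alpha>\<beta>] .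
    finally show "g (\<phi> a0 (tgt Y f)) = \<phi> (\<alpha> a0) (\<beta> (tgt Y f))"
      using fibrewise_map_arc[OF B'(4) f] by simp
  qed
  then have "g (\<phi> (corner Y a {}) (corner Y b {})) = \<phi> (\<alpha> (corner Y a {})) (\<beta> (corner Y b {}))"
  proof (rule edge_connected_induct[OF A'(3) base(1) ca, of "\<lambda>u. g (\<phi> u (corner Y b {})) = \<phi> (\<alpha> u) (\<beta> (corner Y b {}))"])
    let ?b = "corner Y b {}"
    fix e assume e: "e \<in> A'" "e \<in> arcs Y" and IH: "g (\<phi> (src Y e) ?b) = \<phi> (\<alpha> (src Y e)) (\<beta> ?b)"
    have b: "?b \<in> B'" "?b \<in> B \<inter> vertices Y" and eA: "e \<in> A \<inter> arcs Y" using cb A'(2) B'(2) e by auto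
    have "corner Y ?b {} = ?b" using Y.corner_of_vertex b by blast
    then have eq: "g (\<phi> e ?b) = \<phi> (\<alpha> e) (\<beta> ?b)"
      using cube[OF e(1) b(1)] IH by (simp add: src_def)
    have "p (\<alpha> e) = p e" "\<alpha> e \<in> A" "p (\<beta> ?b) = p ?b" "\<beta> ?b \<in> B"
      using A'(4) B'(4) b(1) e(1) unfolding fibrewise_map_def by blast+
    then have \<alpha>\<beta>: "\<alpha> e \<in> A \<inter> arcs Y" "\<beta> ?b \<in> B \<inter> vertices Y"
      using b e p_cdim A_cubes B_cubes unfolding vertices_def arcs_def by (metis IntI IntD2 mem_Collect_eq)+
    have "g (\<phi> (tgt Y e) ?b) = tgt Y (g (\<phi> e ?b))"
      using product_arc_vertex[OF eA b(2)] cubical_map_arc(3)[OF gD(1)] by metis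
    also have "\<dots> = \<phi> (tgt Y (\<alpha> e)) (\<beta> ?b)"
      unfolding eq using product_arc_vertex(3)[OF \<alpha>\<beta>] .
    finally show "g (\<phi> (tgt Y e) ?b) = \<phi> (\<alpha> (tgt Y e)) (\<beta> ?b)"
      using fibrewise_map_arc[OF A'(4) e] by simp
  qed
  then show ?thesis using cube[OF a b] by simp
qed

lemma stabilizer_A_product:
  assumes g: "g \<in> set_stabilizer (deck_group Y p) A" and ab: "a \<in> A" "b \<in> B"
  shows "g (\<phi> a b) = \<phi> (g a) b"
proof -
  have fw: "fibrewise_map Y p A g A" using deck_fibrewise_map[OF g] A_cubes by blast
  have "g x \<in> A" using fw x_in_A unfolding fibrewise_map_def by blast
  then have "g (\<phi> x x) = \<phi> (g x) x" using product_x_right x_in_A by simp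
  then show ?thesis
    using deck_product_equivariant[OF _ subcomplex_A order_refl edge_connected_A fw subcomplex_B order_refl
        edge_connected_B fibrewise_map_id[OF order_refl] _ _ _ ab] g x_in_A x_in_B x_vertex
    by (auto simp: set_stabilizer_def)
qed

lemma stabilizer_B_product:
  assumes g: "g \<in> set_stabilizer (deck_group Y p) B" and ab: "a \<in> A" "b \<in> B"
  shows "g (\<phi> a b) = \<phi> a (g b)"
proof -
  have fw: "fibrewise_map Y p B g B" using deck_fibrewise_map[OF g] B_cubes by blast
  have "g x \<in> B" using fw x_in_B unfolding fibrewise_map_def by blast
  then have "g (\<phi> x x) = \<phi> x (g x)" using product_x_left x_in_B by simp
  then show ?thesis
    using deck_product_equivariant[OF _ subcomplex_A order_refl edge_connected_A fibrewise_map_id[OF order_refl]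
        subcomplex_B order_refl edge_connected_B fw _ _ _ ab] g x_in_A x_in_B x_vertex
    by (auto simp: set_stabilizer_def)
qed

lemma stabilizer_inverse:
  assumes "g \<in> set_stabilizer (deck_group Y p) S" "S \<subseteq> cubes Y"
  obtains h where "h \<in> set_stabilizer (deck_group Y p) S"
    "\<And>c. c \<in> cubes Y \<Longrightarrow> h (g c) = c" "\<And>c. c \<in> cubes Y \<Longrightarrow> g (h c) = c"
proof -
  have g: "g \<in> carrier (deck_group Y p)" "g ` S = S" using assms(1) by (auto simp: set_stabilizer_def)
  obtain h where h: "h \<in> carrier (deck_group Y p)"
    "\<And>c. c \<in> cubes Y \<Longrightarrow> h (g c) = c" "\<And>c. c \<in> cubes Y \<Longrightarrow> g (h c) = c"
    using deck_group_inverse[OF Y.cube_complex_axioms g(1)] by blast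
  have "h ` S = h ` (g ` S)" using g(2) by simp
  also have "\<dots> = S" using h(2) assms(2) by (force simp: image_image)
  finally show ?thesis using that[of h] h by (simp add: set_stabilizer_def)
qed

lemma stabilizer_preserves_P:
  assumes g: "g \<in> set_stabilizer (deck_group Y p) A \<union> set_stabilizer (deck_group Y p) B"
  shows "g ` P = P"
proof -
  have sub: "g c \<in> P"
    if g: "g \<in> set_stabilizer (deck_group Y p) A \<union> set_stabilizer (deck_group Y p) B" and c: "c \<in> P" for g c
  proof -
    note gD = deck_groupD(1)[of g Y p]
    obtain a b where ab: "a \<in> A" "b \<in> B" "cell Y c = cell Y (\<phi> a b)" using product_surj[OF c] by blast
    then obtain k where k: "cube_emb (cdim Y (\<phi> a b)) (cdim Y (\<phi> a b)) k"
      "c = pull Y (cdim Y (\<phi> a b)) k (\<phi> a b)"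
      using Y.cell_eqD[OF P_cubes[OF c] ab(3)] by blast
    have gcub: "cubical_map Y g Y" using g gD by (auto simp: set_stabilizer_def)
    have "g (\<phi> a b) \<in> P"
    proof (cases "g \<in> set_stabilizer (deck_group Y p) A")
      case True
      then have "g a \<in> A" using ab(1) by (auto simp: set_stabilizer_def)
      then show ?thesis using stabilizer_A_product[OF True ab(1,2)] product_in ab(2) by simp
    next
      case False
      then have B: "g \<in> set_stabilizer (deck_group Y p) B" using g by simp
      then have "g b \<in> B" using ab(2) by (auto simp: set_stabilizer_def)
      then show ?thesis using stabilizer_B_product[OF B ab(1,2)] product_in ab(1) by simp
    qed
    moreover have "g c = pull Y (cdim Y (\<phi> a b)) k (g (\<phi> a b))" "cdim Y (g (\<phi> a b)) = cdim Y (\<phi> a b)"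
      using gcub k product_cubes[OF ab(1,2)] unfolding cubical_map_def by blast+
    ultimately show ?thesis
      using subcomplexD(2)[OF convex_subcomplexD(1)[OF convex_P]] k(1) by simp
  qed
  have AB: "A \<subseteq> cubes Y" "B \<subseteq> cubes Y" using A_cubes B_cubes by auto
  obtain h where h: "h \<in> set_stabilizer (deck_group Y p) A \<union> set_stabilizer (deck_group Y p) B"
    "\<And>c. c \<in> cubes Y \<Longrightarrow> g (h c) = c"
    using g stabilizer_inverse[OF _ AB(1), of g] stabilizer_inverse[OF _ AB(2), of g] by (metis Un_iff)
  show ?thesis
  proof
    show "g ` P \<subseteq> P" using sub[OF g] by blast
    show "P \<subseteq> g ` P"
    proof
      fix c assume c: "c \<in> P"
      then show "c \<in> g ` P" using sub[OF h(1) c] h(2)[OF P_cubes[OF c]] by force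
    qed
  qed
qed

text \<open>
  Both products send \<open>x\<close> to \<open>\<phi> (g x) (h x)\<close>.
\<close>

lemma stabilizers_commute:
  assumes g: "g \<in> set_stabilizer (deck_group Y p) A" and h: "h \<in> set_stabilizer (deck_group Y p) B"
  shows "g \<otimes>\<^bsub>deck_group Y p\<^esub> h = h \<otimes>\<^bsub>deck_group Y p\<^esub> g"
proof -
  interpret G: group "deck_group Y p" by (rule group_deck_group[OF Y.cube_complex_axioms])
  have gh: "g \<in> carrier (deck_group Y p)" "h \<in> carrier (deck_group Y p)"
    using g h by (auto simp: set_stabilizer_def)
  have xY: "x \<in> cubes Y" using x_vertex by (simp add: vertices_def)
  have gx: "g x \<in> A" "h x \<in> B" using g h x_in_A x_in_B by (auto simp: set_stabilizer_def)
  have "(g \<otimes>\<^bsub>deck_group Y p\<^esub> h) x = g (\<phi> x (h x))"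
    using deck_group_mult_apply[OF gh xY] product_x_left[OF gx(2)] by simp
  also have "\<dots> = \<phi> (g x) (h x)" using stabilizer_A_product[OF g x_in_A gx(2)] .
  also have "\<dots> = h (\<phi> (g x) x)" using stabilizer_B_product[OF h gx(1) x_in_B] by simp
  also have "\<dots> = (h \<otimes>\<^bsub>deck_group Y p\<^esub> g) x"
    using deck_group_mult_apply[OF gh(2,1) xY] product_x_right[OF gx(1)] by simp
  finally show ?thesis using deck_eqI[OF connected _ _ x_vertex] gh by blast
qed

text \<open>
  This is \<open>deck_product_equivariant\<close> for the identity of \<open>A\<close> and the map \<open>{b} \<rightarrow> {g b}\<close>.
\<close>

lemma deck_product_slice:
  assumes g: "g \<in> carrier (deck_group Y p)" and b: "b \<in> B \<inter> vertices Y" "g b \<in> B"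
    and a: "a \<in> A"
  shows "g (\<phi> a b) = \<phi> a (g b)"
proof -
  have bv: "b \<in> cubes Y" "cdim Y b = 0" using b by (auto simp: vertices_def)
  have gb: "g b \<in> vertices Y" using cubical_map_vertex[OF deck_groupD(1)[OF g]] b by blast
  have self: "pull Y 0 (id_emb 0) b = b" "pull Y 0 (id_emb 0) (g b) = g b"
    using Y.pull_id[of b] Y.pull_id[of "g b"] gb bv by (auto simp: vertices_def)
  have face: "pull Y m f b = b" "pull Y m f (g b) = g b" if "cube_emb m (cdim Y b) f" for m f
  proof -
    have "m = 0" "f = id_emb 0" using cube_emb_zero that unfolding bv(2) by blast+
    then show "pull Y m f b = b" "pull Y m f (g b) = g b" using self by (simp_all only:)
  qed
  have "subcomplex Y {b}" "fibrewise_map Y p {b} (\<lambda>_. g b) B"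
    using face bv(1) b(2) deck_groupD(4)[OF g bv(1)] unfolding subcomplex_def fibrewise_map_def by simp_all
  moreover have "edge_path Y b [] b" using b by simp
  then have "edge_connected Y {b}" unfolding edge_connected_def using b by (auto intro!: exI[of _ "[]"])
  moreover have "g (\<phi> x b) = \<phi> x (g b)" using product_x_left b by simp
  ultimately show ?thesis
    using deck_product_equivariant[OF g subcomplex_A order_refl edge_connected_A fibrewise_map_id[OF order_refl],
        of "{b}" "\<lambda>_. g b" x b a b] x_in_A x_vertex a b by simp
qed

end

section \<open>The orthogonal complement and its quotient\<close>

locale covered_complement = covered_product +
  assumes slices: "{A'. parallel_subcomplex Y A' A} = {slice \<phi> A b | b. b \<in> B \<inter> vertices Y}"
begin

lemma slice_parallel: "b \<in> B \<inter> vertices Y \<Longrightarrow> parallel_subcomplex Y (slice \<phi> A b) A"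
  using slices by blast

text \<open>
  All slices have the hyperplanes of \<open>A\<close>, and \<open>g\<close> takes the slice at \<open>b\<close> to another one. So \<open>g\<close>
  preserves this set of hyperplanes, and the image of any slice is again parallel to \<open>A\<close>.
\<close>

lemma deck_image_slice:
  assumes g: "g \<in> carrier (deck_group Y p)" and b: "b \<in> B \<inter> vertices Y" "g b \<in> B"
    and b': "b' \<in> B \<inter> vertices Y"
  shows "\<exists>b''\<in>B \<inter> vertices Y. g ` slice \<phi> A b' = slice \<phi> A b''"
proof -
  note gD = deck_groupD[OF g]
  have gb: "g b \<in> B \<inter> vertices Y" using cubical_map_vertex[OF gD(1)] b by blast
  have g_slice: "g ` slice \<phi> A b = slice \<phi> A (g b)"
    unfolding slice_def image_image using deck_product_slice[OF g b] by simp
  have par: "hyperplanes_of Y (slice \<phi> A c) = hyperplanes_of Y A" "slice \<phi> A c \<subseteq> cubes Y"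
    "convex_subcomplex Y (slice \<phi> A c)" if "c \<in> B \<inter> vertices Y" for c
    using slice_parallel[OF that] convex_subcomplexD(3) unfolding parallel_subcomplex_def by blast+
  \<comment> \<open>Equality of hyperplane sets is kept by \<open>g\<close>, and at \<open>b\<close> the image is known to be a slice.\<close>
  have "hyperplanes_of Y (g ` slice \<phi> A b') = hyperplanes_of Y (g ` slice \<phi> A b)"
    using Y.hyperplanes_of_image_mono[OF gD(1) par(2)[OF b'] par(2)[OF b(1)]]
      Y.hyperplanes_of_image_mono[OF gD(1) par(2)[OF b(1)] par(2)[OF b']]
      par(1)[OF b'] par(1)[OF b(1)] by simp
  then have "hyperplanes_of Y (g ` slice \<phi> A b') = hyperplanes_of Y A"
    using g_slice par(1)[OF gb] by simp
  moreover obtain h where h: "h \<in> carrier (deck_group Y p)"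
    "\<And>c. c \<in> cubes Y \<Longrightarrow> h (g c) = c" "\<And>c. c \<in> cubes Y \<Longrightarrow> g (h c) = c"
    using deck_group_inverse[OF Y.cube_complex_axioms g] by blast
  then have "convex_subcomplex Y (g ` slice \<phi> A b')"
    using Y.convex_subcomplex_image[OF par(3)[OF b'] gD(1) deck_groupD(1)[OF h(1)] h(2,3)] by blast
  ultimately have "parallel_subcomplex Y (g ` slice \<phi> A b') A" unfolding parallel_subcomplex_def by blast
  then show ?thesis using slices by blast
qed

text \<open>
  Both ends of \<open>g f\<close> lie in slices, hence \<open>g f\<close> lies in the product. If it were in the direction of
  \<open>A\<close>, it would lie in the slice at \<open>g (src f)\<close>, the image of the slice at \<open>src f\<close>, and then \<open>f\<close>
  would be both an edge of this slice and an edge of \<open>B\<close>.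
\<close>

lemma deck_preserves_B_step:
  assumes g: "g \<in> carrier (deck_group Y p)" and f: "f \<in> B" "f \<in> arcs Y" and gb: "g (src Y f) \<in> B"
  shows "g f \<in> B"
proof -
  note gD = deck_groupD[OF g] and gf = cubical_map_arc[OF deck_groupD(1)[OF g] f(2)]
  have ends: "src Y f \<in> B \<inter> vertices Y" "tgt Y f \<in> B \<inter> vertices Y"
    using subcomplex_arcD[OF subcomplex_B f] Y.src_vertex Y.tgt_vertex f by auto
  have gb': "g (src Y f) \<in> B \<inter> vertices Y" using cubical_map_vertex[OF gD(1)] ends gb by blast
  have B_P: "B \<subseteq> P" using Hull_superset[of "A \<union> B" Y] by blast
  obtain c where c: "c \<in> B \<inter> vertices Y" "g ` slice \<phi> A (tgt Y f) = slice \<phi> A c"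
    using deck_image_slice[OF g ends(1) gb ends(2)] by blast
  have "tgt Y f \<in> slice \<phi> A (tgt Y f)"
    unfolding slice_def using product_x_left ends(2) x_in_A by force
  then have "g (tgt Y f) \<in> slice \<phi> A c" using c(2) by blast
  then have "g (tgt Y f) \<in> P" using product_in c(1) unfolding slice_def by auto
  then have "g f \<in> P"
    using convex_subcomplex_arcI[OF convex_P gf(1)] gf gb B_P by auto
  then show ?thesis using gf(1)
  proof (cases rule: product_arc_cases)
    case (left a b)
    have "\<phi> (src Y a) b = \<phi> x (g (src Y f))"
      using product_arc_vertex(2)[OF left(1,2)] left(3) gf(2) product_x_left gb by metis
    then have "b = g (src Y f)"
      using product_vertex_inj(2)[of "src Y a" b x "g (src Y f)"] left gb' x_in_A x_vertex
        subcomplex_arcD[OF subcomplex_A] Y.src_vertex by blast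
    then have "g f = g (\<phi> a (src Y f))"
      using deck_product_slice[OF g ends(1) gb] left(1,3) by simp
    moreover have "f \<in> cubes Y" "\<phi> a (src Y f) \<in> cubes Y"
      using f B_cubes product_cubes left(1) ends by auto
    ultimately have "\<phi> x f = \<phi> a (src Y f)"
      using gD(2) product_x_left[OF f(1)] by (metis bij_betw_imp_inj_on inj_onD)
    then have "cell Y x = cell Y a"
      using product_inj[of x f a "src Y f"] x_in_A f left(1) ends by auto
    then have "cdim Y x = cdim Y a" using Y.cell_eq_cdim A_cubes x_in_A left(1) by blast
    then show ?thesis using left(1) x_vertex by (simp add: arcs_def vertices_def)
  next
    case (right a b)
    have "\<phi> a (src Y b) = \<phi> x (g (src Y f))"
      using product_vertex_arc(2)[OF right(1,2)] right(3) gf(2) product_x_left gb by metis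
    then have "a = x"
      using product_vertex_inj(1)[of a "src Y b" x "g (src Y f)"] right gb' x_in_A x_vertex
        subcomplex_arcD[OF subcomplex_B] Y.src_vertex by blast
    then show ?thesis using right product_x_left by auto
  qed
qed

text \<open>
  Edges carry the claim from one vertex of \<open>B\<close> to all of them. A cube belongs to \<open>B\<close> as soon as its
  corners do, since \<open>B\<close> is a full subcomplex.
\<close>

lemma deck_preserves_B:
  assumes g: "g \<in> carrier (deck_group Y p)" and b: "b \<in> B \<inter> vertices Y" "g b \<in> B"
  shows "g ` B \<subseteq> B"
proof
  note gD = deck_groupD[OF g]
  have vert: "g v \<in> B" if "v \<in> B \<inter> vertices Y" for v
  proof (rule edge_connected_induct[OF edge_connected_B b(1) that, of "\<lambda>v. g v \<in> B"])
    show "g b \<in> B" by fact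
    fix f assume f: "f \<in> B" "f \<in> arcs Y" and "g (src Y f) \<in> B"
    then have "g f \<in> B" using deck_preserves_B_step[OF g] by blast
    then have "tgt Y (g f) \<in> B"
      using subcomplex_arcD(2)[OF subcomplex_B] cubical_map_arc(1)[OF gD(1) f(2)] by blast
    then show "g (tgt Y f) \<in> B" using cubical_map_arc(3)[OF gD(1) f(2)] by simp
  qed
  fix d assume "d \<in> g ` B"
  then obtain c where c: "c \<in> B" "d = g c" by blast
  have cY: "c \<in> cubes Y" "g c \<in> cubes Y" "cdim Y (g c) = cdim Y c"
    using B_cubes[OF c(1)] gD(1) by (auto simp: cubical_map_def)
  have "corner Y (g c) u \<in> B" if "u \<subseteq> {..<cdim Y (g c)}" for u
  proof -
    have u: "u \<subseteq> {..<cdim Y c}" using that cY by simp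
    have "g (corner Y c u) \<in> B"
      using vert subcomplexD(3)[OF subcomplex_B c(1) u] Y.corner_vertex[OF cY(1) u] by blast
    then show ?thesis using cubical_map_corner[OF gD(1) cY(1) u] by simp
  qed
  then show "d \<in> B" unfolding c(2) by (rule convex_subcomplexD(5)[OF convex_B cY(2)])
qed

text \<open>
  Cubes of \<open>B\<close> with equal images have base corners in one fibre, and a deck transformation relating these
  corners also relates the cubes. It preserves \<open>B\<close> because \<open>deck_preserves_B\<close> applies to it and to its
  inverse.
\<close>

lemma fibre_stabilizer_transitive:
  assumes sc: "simply_connected_complex Y" and c: "c1 \<in> B" "c2 \<in> B" and pc: "p c1 = p c2"
  obtains g where "g \<in> set_stabilizer (deck_group Y p) B" "g c1 = c2"
proof -
  have cY: "c1 \<in> cubes Y" "c2 \<in> cubes Y" using c B_cubes by auto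
  define b1 b2 where "b1 = corner Y c1 {}" and "b2 = corner Y c2 {}"
  have b: "b1 \<in> B \<inter> vertices Y" "b2 \<in> B \<inter> vertices Y"
    unfolding b1_def b2_def
    using subcomplexD(3)[OF subcomplex_B] c Y.corner_vertex cY by auto
  have "p b1 = p b2"
    unfolding b1_def b2_def
    using cubical_map_corner[OF cubical cY(1) empty_subsetI]
      cubical_map_corner[OF cubical cY(2) empty_subsetI] pc by simp
  then obtain g where g: "g \<in> carrier (deck_group Y p)" "g b1 = b2"
    using deck_group_transitive_on_fibres[OF sc] b by blast
  obtain h where h: "h \<in> carrier (deck_group Y p)"
    "\<And>c. c \<in> cubes Y \<Longrightarrow> h (g c) = c" "\<And>c. c \<in> cubes Y \<Longrightarrow> g (h c) = c"
    using deck_group_inverse[OF Y.cube_complex_axioms g(1)] by blast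
  have "h b2 = b1" using h(2)[of b1] b g(2) by (simp add: vertices_def)
  then have hB: "h ` B \<subseteq> B" using deck_preserves_B[OF h(1) b(2)] b(1) by simp
  have gB: "g ` B \<subseteq> B" using deck_preserves_B[OF g(1) b(1)] b(2) g(2) by simp
  have "B \<subseteq> g ` B"
  proof
    fix c assume "c \<in> B"
    then show "c \<in> g ` B" using hB h(3)[OF B_cubes] by (metis image_eqI image_subset_iff)
  qed
  then have stab: "g \<in> set_stabilizer (deck_group Y p) B"
    using g(1) gB by (auto simp: set_stabilizer_def)
  have "g c1 = c2"
  proof (rule lift_unique)
    show "g c1 \<in> cubes Y" "c2 \<in> cubes Y" using gB c B_cubes by auto
    show "corner Y (g c1) {} = corner Y c2 {}"
      using cubical_map_corner[OF deck_groupD(1)[OF g(1)] cY(1) empty_subsetI] g(2)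
      by (simp add: b1_def b2_def)
    show "p (g c1) = p c2" using deck_groupD(4)[OF g(1) cY(1)] pc by simp
  qed
  then show ?thesis using that stab by blast
qed

lemma quotient_embeds_B:
  assumes sc: "simply_connected_complex Y"
  shows "quotient_embeds p (set_stabilizer (deck_group Y p) B) B"
proof -
  let ?K = "set_stabilizer (deck_group Y p) B"
  interpret G: group "deck_group Y p" by (rule group_deck_group[OF Y.cube_complex_axioms])
  have B: "B \<subseteq> cubes Y" using B_cubes by blast
  have orbit_image: "the_elem (p ` {g c | g. g \<in> ?K}) = p c" if c: "c \<in> B" for c
  proof -
    obtain k where "k \<in> ?K" using fibre_stabilizer_transitive[OF sc c c] by blast
    moreover have "p (g c) = p c" if "g \<in> ?K" for g
      using deck_groupD(4)[of g Y p c] that B c by (auto simp: set_stabilizer_def)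
    ultimately have "p ` {g c | g. g \<in> ?K} = {p c}"
      by (auto intro!: image_eqI[of _ p "k c"])
    then show ?thesis by simp
  qed
  have orbit_sub: "{h c2 | h. h \<in> ?K} \<subseteq> {h c1 | h. h \<in> ?K}"
    if g: "g \<in> ?K" "g c1 = c2" and c1: "c1 \<in> B" for g c1 c2
  proof
    fix d assume "d \<in> {h c2 | h. h \<in> ?K}"
    then obtain h where h: "h \<in> ?K" "d = h c2" by blast
    let ?k = "h \<otimes>\<^bsub>deck_group Y p\<^esub> g"
    have carr: "h \<in> carrier (deck_group Y p)" "g \<in> carrier (deck_group Y p)"
      using h g by (auto simp: set_stabilizer_def)
    have app: "?k c = h (g c)" if "c \<in> B" for c
      using deck_group_mult_apply[OF carr] B that by blast
    have "?k ` B = h ` (g ` B)" using app by (auto simp: image_image)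
    then have "?k \<in> ?K" using carr h g by (simp add: set_stabilizer_def)
    moreover have "d = ?k c1" using app[OF c1] h(2) g(2) by simp
    ultimately show "d \<in> {h c1 | h. h \<in> ?K}" by blast
  qed
  show ?thesis
    unfolding quotient_embeds_def orbits_under_def
  proof (rule inj_onI, clarify)
    fix c1 c2 assume c: "c1 \<in> B" "c2 \<in> B"
      and "the_elem (p ` {g c1 | g. g \<in> ?K}) = the_elem (p ` {g c2 | g. g \<in> ?K})"
    then have pc: "p c1 = p c2" using orbit_image by simp
    obtain g where "g \<in> ?K" "g c1 = c2" using fibre_stabilizer_transitive[OF sc c pc] by blast
    moreover obtain h where "h \<in> ?K" "h c2 = c1"
      using fibre_stabilizer_transitive[OF sc c(2,1) pc[symmetric]] by blast
    ultimately show "{g c1 | g. g \<in> ?K} = {g c2 | g. g \<in> ?K}"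
      using orbit_sub c by (intro equalityI) blast+
  qed
qed

end

theorem proposition3p14:
  fixes X :: "'b cubical" and Xt :: "'a cubical" and p :: "'a \<Rightarrow> 'b"
    and A B :: "'a set" and x :: 'a
  assumes "cube_complex X" and "connected_complex X" and "weakly_special X"
    and "universal_cover Xt p X"
    and "convex_subcomplex Xt A" and "x \<in> vertices Xt" and "x \<in> A"
    and "orthogonal_complement Xt A x B"
  shows
    "let G = deck_group Xt p;
         GA = set_stabilizer G A;
         GB = set_stabilizer G B;
         P = Hull Xt (A \<union> B)
     in quotient_embeds p GB B \<and>
        (\<forall>g\<in>GA. \<forall>h\<in>GB. g \<otimes>\<^bsub>G\<^esub> h = h \<otimes>\<^bsub>G\<^esub> g) \<and>
        (\<forall>g\<in>GA \<union> GB. g ` P = P) \<and>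
        (\<forall>\<phi>. product_iso Xt A B x \<phi> \<longrightarrow>
           (\<forall>g\<in>GA. \<forall>a\<in>A. \<forall>b\<in>B. g (\<phi> a b) = \<phi> (g a) b) \<and>
           (\<forall>g\<in>GB. \<forall>a\<in>A. \<forall>b\<in>B. g (\<phi> a b) = \<phi> a (g b)))"
proof -
  interpret Xt: cube_complex Xt using assms(4) by (simp add: universal_cover_def)
  have sc: "simply_connected_complex Xt" and cov: "covering_map_of Xt p X"
    using assms(4) by (simp_all add: universal_cover_def)
  have orth: "convex_subcomplex Xt B" "A \<inter> B = {x}"
    using assms(8) by (simp_all add: orthogonal_complement_def orthogonal_at_def)
  have covered_productI: "covered_product Xt X p A B x \<phi>" if "product_iso Xt A B x \<phi>" for \<phi>
  proof -
    interpret X: cube_complex X by fact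
    show ?thesis
      using assms(3,5-7) sc cov orth that
      by unfold_locales (auto simp: simply_connected_complex_def)
  qed
  obtain \<phi> where \<phi>: "product_iso Xt A B x \<phi>"
    "{A'. parallel_subcomplex Xt A' A} = {slice \<phi> A b | b. b \<in> B \<inter> vertices Xt}"
    using assms(8) unfolding orthogonal_complement_def by blast
  interpret covered_product Xt X p A B x \<phi> by (rule covered_productI[OF \<phi>(1)])
  interpret covered_complement Xt X p A B x \<phi> by unfold_locales (rule \<phi>(2))
  show ?thesis
    unfolding Let_def
  proof (intro conjI ballI allI impI)
    show "quotient_embeds p (set_stabilizer (deck_group Xt p) B) B"
      by (rule quotient_embeds_B[OF sc])
  next
    fix g h assume "g \<in> set_stabilizer (deck_group Xt p) A" "h \<in> set_stabilizer (deck_group Xt p) B"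
    then show "g \<otimes>\<^bsub>deck_group Xt p\<^esub> h = h \<otimes>\<^bsub>deck_group Xt p\<^esub> g"
      by (rule stabilizers_commute)
  next
    fix g assume "g \<in> set_stabilizer (deck_group Xt p) A \<union> set_stabilizer (deck_group Xt p) B"
    then show "g ` P = P" by (rule stabilizer_preserves_P)
  next
    fix \<psi> g a b
    assume \<psi>: "product_iso Xt A B x \<psi>" and ab: "a \<in> A" "b \<in> B"
    show "g (\<psi> a b) = \<psi> (g a) b" if "g \<in> set_stabilizer (deck_group Xt p) A"
      using covered_product.stabilizer_A_product[OF covered_productI[OF \<psi>] that ab] .
    show "g (\<psi> a b) = \<psi> a (g b)" if "g \<in> set_stabilizer (deck_group Xt p) B"
      using covered_product.stabilizer_B_product[OF covered_productI[OF \<psi>] that ab] .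
  qed
qed

end
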